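(* Let $H^{m',n'}_{p',q'}\left[t\,\Big|\begin{array}{c}(\alpha'_j,A'_j)_1^{p'}\\(\beta'_j,B'_j)_1^{q'}\end{array}\right]$ be a Fox $H$-function with real $\alpha'_j,\beta'_j$ and positive $A'_j,B'_j$ which is defined and positive for every $t>0$. Assume $m'n'>0$ and $$\chi'=\sum_{j=1}^{n'}A'_j-\sum_{j=n'+1}^{p'}A'_j+\sum_{j=1}^{m'}B'_j-\sum_{j=m'+1}^{q'}B'_j>0 .$$ Let $k\in\mathbb{N}$, and let $\omega_1,\dots,\omega_k\in\mathbb{R}$ and $\lambda_1,\dots,\lambda_k>0$ satisfy $$\omega_j+\lambda_j\min_{l=1,\dots,m'}\left\{\frac{\beta'_l}{B'_l}\right\}>0,\qquad j=1,\dots,k.$$ Then $$H^{m',n'+k}_{p'+k,q'}\left[t\,\Big|\begin{array}{c}(1-\omega_{k-j+1},\lambda_{k-j+1})_1^{k},\,(\alpha'_j,A'_j)_1^{p'}\\(\beta'_j,B'_j)_1^{q'}\end{array}\right]>0\qquad\text{for every }t>0.$$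
   Context: $\mathbb{N}=\{1,2,\dots\}$, $\mathbb{N}_0=\mathbb{N}\cup\{0\}$. The notation $(x_j,X_j)_1^l$ stands for the list $(x_1,X_1),\dots,(x_l,X_l)$ (the empty list if $l=0$); lists separated by commas are concatenated. Thus $(1-\omega_{k-j+1},\lambda_{k-j+1})_1^k$ is $(1-\omega_k,\lambda_k),\dots,(1-\omega_1,\lambda_1)$. Fox $H$-function. For $0\le n\le p$, $0\le m\le q$, $A_j,B_j>0$, $\alpha_j,\beta_j\in\mathbb{C}$ with $A_j(l+\beta_{j'})\ne B_{j'}(\alpha_j-l'-1)$ for all $1\le j\le n$, $1\le j'\le m$, $l,l'\in\mathbb{N}_0$, put $$\Xi^{m,n}_{p,q}(s)=\frac{\prod_{j=1}^m\Gamma(\beta_j+B_js)\prod_{j=1}^n\Gamma(1-\alpha_j-A_js)}{\prod_{j=m+1}^q\Gamma(1-\beta_j-B_js)\prod_{j=n+1}^p\Gamma(\alpha_j+A_js)}$$ (empty products are $1$), and $$H^{m,n}_{p,q}\left[z\,\Big|\begin{array}{c}(\alpha_j,A_j)_1^p\\(\beta_j,B_j)_1^q\end{array}\right]=\frac{1}{2\pi i}\int_{\mathcal C}\Xi^{m,n}_{p,q}(s)\,z^{-s}\,ds .$$ Let $\chi=\sum_{j=1}^nA_j-\sum_{j=n+1}^pA_j+\sum_{j=1}^mB_j-\sum_{j=m+1}^qB_j$. When $\chi>0$ (as is the case for all $H$-functions here) and $z>0$, $\mathcal C$ is a contour going from $\gamma-i\infty$ to $\gamma+i\infty$ ($\gamma\in\mathbb{R}$),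 leaving all poles of $\Gamma(\beta_j+B_js)$, $1\le j\le m$, on its left and all poles of $\Gamma(1-\alpha_j-A_js)$, $1\le j\le n$, on its right; the integral converges and does not depend on the choice of such a contour. *)

theory Defs
  imports "HOL-Complex_Analysis.Complex_Analysis"
begin

text \<open>
  The parameters of a Fox H-function are two lists of pairs: \<open>as\<close> for the upper row
  \<open>(\<alpha>\<^sub>1, A\<^sub>1), \<dots>, (\<alpha>\<^sub>p, A\<^sub>p)\<close> and \<open>bs\<close> for the lower row \<open>(\<beta>\<^sub>1, B\<^sub>1), \<dots>, (\<beta>\<^sub>q, B\<^sub>q)\<close>.
  So \<open>p = length as\<close>, \<open>q = length bs\<close>, and \<open>take n as\<close>, \<open>drop n as\<close> hold the pairs with
  index at most \<open>n\<close> and greater than \<open>n\<close>.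
\<close>

type_synonym fox_params = "(complex \<times> real) list"

text \<open>The list \<open>(x\<^sub>j, X\<^sub>j)\<^sub>1\<^sup>l\<close>; the index starts at 1.\<close>

definition fox_list :: "(nat \<Rightarrow> complex) \<Rightarrow> (nat \<Rightarrow> real) \<Rightarrow> nat \<Rightarrow> fox_params" where
  "fox_list x X l = map (\<lambda>j. (x j, X j)) [1..<l + 1]"

definition fox_defined :: "nat \<Rightarrow> nat \<Rightarrow> fox_params \<Rightarrow> fox_params \<Rightarrow> bool" where
  "fox_defined m n as bs \<longleftrightarrow>
     n \<le> length as \<and> m \<le> length bs \<and>
     (\<forall>(\<alpha>, A) \<in> set as. A > 0) \<and> (\<forall>(\<beta>, B) \<in> set bs. B > 0) \<and>
     (\<forall>(\<alpha>, A) \<in> set (take n as). \<forall>(\<beta>, B) \<in> set (take m bs). \<forall>l l' :: nat.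
        of_real A * (of_nat l + \<beta>) \<noteq> of_real B * (\<alpha> - of_nat l' - 1))"

text \<open>
  In the library \<open>Gamma\<close> is 0 at its poles and \<open>x / 0 = 0\<close>, so a Gamma factor in the
  denominator that has a pole makes the quotient 0, which is the value given by the
  entire function \<open>1/\<Gamma>\<close>.
\<close>

definition fox_Xi :: "nat \<Rightarrow> nat \<Rightarrow> fox_params \<Rightarrow> fox_params \<Rightarrow> complex \<Rightarrow> complex" where
  "fox_Xi m n as bs s =
     ((\<Prod>(\<beta>, B) \<leftarrow> take m bs. Gamma (\<beta> + of_real B * s)) *
      (\<Prod>(\<alpha>, A) \<leftarrow> take n as. Gamma (1 - \<alpha> - of_real A * s))) /
     ((\<Prod>(\<beta>, B) \<leftarrow> drop m bs. Gamma (1 - \<beta> - of_real B * s)) *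
      (\<Prod>(\<alpha>, A) \<leftarrow> drop n as. Gamma (\<alpha> + of_real A * s)))"

definition fox_chi :: "nat \<Rightarrow> nat \<Rightarrow> fox_params \<Rightarrow> fox_params \<Rightarrow> real" where
  "fox_chi m n as bs =
     (\<Sum>(\<alpha>, A) \<leftarrow> take n as. A) - (\<Sum>(\<alpha>, A) \<leftarrow> drop n as. A) +
     (\<Sum>(\<beta>, B) \<leftarrow> take m bs. B) - (\<Sum>(\<beta>, B) \<leftarrow> drop m bs. B)"

text \<open>
  A contour from \<open>\<gamma> - i\<infinity>\<close> to \<open>\<gamma> + i\<infinity>\<close>: a simple piecewise \<open>C\<^sup>1\<close> curve that
  agrees with the upward vertical line \<open>Re s = \<gamma>\<close> outside a bounded parameter interval.
\<close>

definition vertical_contour :: "real \<Rightarrow> (real \<Rightarrow> complex) \<Rightarrow> bool" where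
  "vertical_contour \<gamma> c \<longleftrightarrow>
     inj c \<and>
     (\<exists>R>0. c piecewise_C1_differentiable_on {-R..R} \<and> (\<forall>t. \<bar>t\<bar> \<ge> R \<longrightarrow> c t = Complex \<gamma> t))"

text \<open>
  The two sides of such a contour are the components of its complement; it is traversed
  upwards, so its left side is the component that contains the reals close to \<open>-\<infinity>\<close>, and
  its right side the one that contains the reals close to \<open>+\<infinity>\<close>.
\<close>

definition left_side :: "(real \<Rightarrow> complex) \<Rightarrow> complex set" where
  "left_side c = {w. \<forall>\<^sub>F x in at_bot. connected_component (- range c) w (complex_of_real x)}"

definition right_side :: "(real \<Rightarrow> complex) \<Rightarrow> complex set" where
  "right_side c = {w. \<forall>\<^sub>F x in at_top. connected_component (- range c) w (complex_of_real x)}"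

text \<open>The set \<open>\<int>\<^sub>\<le>\<^sub>0\<close> is the set of poles of \<open>Gamma\<close>.\<close>

definition fox_contour :: "nat \<Rightarrow> nat \<Rightarrow> fox_params \<Rightarrow> fox_params \<Rightarrow> (real \<Rightarrow> complex) \<Rightarrow> bool" where
  "fox_contour m n as bs c \<longleftrightarrow>
     (\<exists>\<gamma>. vertical_contour \<gamma> c) \<and>
     (\<forall>(\<beta>, B) \<in> set (take m bs). {s. \<beta> + of_real B * s \<in> \<int>\<^sub>\<le>\<^sub>0} \<subseteq> left_side c) \<and>
     (\<forall>(\<alpha>, A) \<in> set (take n as). {s. 1 - \<alpha> - of_real A * s \<in> \<int>\<^sub>\<le>\<^sub>0} \<subseteq> right_side c)"

text \<open>
  The H-function at \<open>z > 0\<close> in the case \<open>\<chi> > 0\<close>, in which the integral converges and does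
  not depend on the contour, so any admissible contour may be selected. It is meaningful
  only if \<open>fox_defined m n as bs\<close> holds.
\<close>

definition fox_H :: "nat \<Rightarrow> nat \<Rightarrow> fox_params \<Rightarrow> fox_params \<Rightarrow> real \<Rightarrow> complex" where
  "fox_H m n as bs z =
     (let c = (SOME c. fox_contour m n as bs c) in
        1 / (2 * of_real pi * \<i>) *
        integral UNIV (\<lambda>t. fox_Xi m n as bs (c t) * of_real z powr (- c t) * vector_derivative c (at t)))"

definition positive_complex :: "complex \<Rightarrow> bool" where
  "positive_complex w \<longleftrightarrow> w \<in> \<real> \<and> Re w > 0"

end

theory Submission
  imports Defs
begin

text \<open>
  It suffices to prepend a single pair \<open>(1 - \<omega>, \<lambda>)\<close>. This multiplies the integrand by
  \<open>\<Gamma>(\<omega> - \<lambda> s) = \<integral>\<^sub>0\<^sup>\<infinity> u\<^bsup>\<omega> - \<lambda> s - 1\<^esup> e\<^bsup>-u\<^esup> du\<close>, provided that \<open>Re s < \<omega> / \<lambda>\<close> on the contour,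
  and Fubini's theorem gives \<open>H\<^sub>n\<^sub>e\<^sub>w(t) = \<integral>\<^sub>0\<^sup>\<infinity> u\<^bsup>\<omega> - 1\<^esup> e\<^bsup>-u\<^esup> H(t u\<^bsup>\<lambda>\<^esup>) du > 0\<close>. By the hypothesis on
  \<open>\<omega>\<close> and \<open>\<lambda>\<close>, every pole to be left of the contour is smaller than \<open>\<omega> / \<lambda>\<close>, so such a contour
  exists, although in general it has to cross the real axis several times. That the chosen contour
  may be replaced by this one follows from the homological form of Cauchy's theorem, since
  \<open>\<chi> > 0\<close> makes the integrand decay exponentially in vertical strips: \<open>\<bar>\<Gamma>(x + \<i>t)\<bar>\<close> is
  \<open>exp (- \<pi> \<bar>t\<bar> / 2)\<close> up to powers of \<open>\<bar>t\<bar>\<close>. The latter holds for \<open>x = 1\<close> by the reflection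
  formula, and in general because \<open>\<bar>\<Gamma>(x + \<i>t)\<bar> / \<Gamma>(x)\<close> is increasing in \<open>x > 0\<close>.
\<close>

section \<open>Exponential bounds for the Gamma function in vertical strips\<close>

text \<open>\<open>fox_H\<close> selects its contour by choice, so the contours behind the old and
  the new function are unrelated, and each may wind between the poles in an uncontrolled way. Both
  functions are therefore rewritten along one contour built for the new parameters; it suits the old
  ones as well, since prepending a pair only enlarges the set of poles on the right. Comparing
  contours takes neither crossing combinatorics nor the Jordan curve theorem: a point on the same
  side of two contours has index zero with respect to any tall enough loop between them, because
  both can be closed up far away on the opposite side.

  A vertical line would do if all left poles preceded all right poles. Only disjointness is given,
  so the two kinds may alternate along the real axis; that all poles are real is what lets a shear
  separate them.

  The case of one pair reproduces its own hypotheses: the lower row is untouched, so the bound on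
  \<open>\<omega>\<close> and \<open>\<lambda>\<close> keeps its meaning, \<open>\<chi>\<close>
  grows by \<open>\<lambda>\<close>, and positivity is both assumed and obtained.\<close>

lemma Gamma_ratio_mono:
  fixes x y t :: real
  assumes "0 < x" "x \<le> y"
  shows "norm (Gamma (Complex x t)) / Gamma x \<le> norm (Gamma (Complex y t)) / Gamma y"
proof -
  have lim: "(\<lambda>n. norm (Gamma_series (Complex x t) n) / Gamma_series x n)
               \<longlonglongrightarrow> norm (Gamma (Complex x t)) / Gamma x" if "x > 0" for x :: real
    using Gamma_real_pos[OF that] by (intro tendsto_intros) auto
  \<comment> \<open>In Gauss's product the factor \<open>n! n^x\<close> cancels against that of the
    real Gamma function. What remains is a product of terms (x + k) / |x + k + it|, each increasing
    in x, and the limit keeps the inequality.\<close>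
  have ratio: "norm (Gamma_series (Complex x t) n) / Gamma_series x n
        = (\<Prod>k\<le>n. (x + real k) / norm (Complex (x + real k) t))" if "x > 0" for x :: real and n
  proof -
    have e: "norm (exp (Complex x t * of_real (ln (real n)))) = exp (x * ln (real n))"
      by simp
    have c: "Complex x t + of_nat k = Complex (x + real k) t" for k
      by (simp add: complex_eq_iff)
    have "norm (Gamma_series (Complex x t) n)
        = fact n * exp (x * ln (real n)) / (\<Prod>k\<le>n. norm (Complex (x + real k) t))"
      by (simp add: Gamma_series_def norm_divide norm_mult pochhammer_prod prod_norm [symmetric]
            c lessThan_Suc_atMost atLeast0LessThan)
    moreover have "Gamma_series x n = fact n * exp (x * ln (real n)) / (\<Prod>k\<le>n. x + real k)"
      by (simp add: Gamma_series_def pochhammer_prod lessThan_Suc_atMost atLeast0LessThan)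
    moreover have "(\<Prod>k\<le>n. x + real k) \<noteq> 0"
      using that by (simp add: add_pos_nonneg less_imp_neq [symmetric])
    ultimately show ?thesis by (simp add: prod_dividef)
  qed
  have step: "a / norm (Complex a t) \<le> b / norm (Complex b t)" if "0 < a" "a \<le> b" for a b :: real
  proof -
    have pos: "sqrt (a\<^sup>2 + t\<^sup>2) > 0" "sqrt (b\<^sup>2 + t\<^sup>2) > 0"
      using that by (auto intro: add_pos_nonneg)
    have "a * sqrt (b\<^sup>2 + t\<^sup>2) = sqrt (a\<^sup>2 * (b\<^sup>2 + t\<^sup>2))"
      using that by (simp add: real_sqrt_mult)
    also have "\<dots> \<le> sqrt (b\<^sup>2 * (a\<^sup>2 + t\<^sup>2))"
      using that by (auto simp: distrib_left intro!: add_mono mult_right_mono power_mono)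
    also have "\<dots> = b * sqrt (a\<^sup>2 + t\<^sup>2)"
      using that by (simp add: real_sqrt_mult)
    finally show ?thesis using pos by (simp add: cmod_def divide_simps mult.commute)
  qed
  show ?thesis
  proof (rule LIMSEQ_le[OF lim lim])
    show "\<exists>N. \<forall>n\<ge>N. norm (Gamma_series (Complex x t) n) / Gamma_series x n
        \<le> norm (Gamma_series (Complex y t) n) / Gamma_series y n"
      using assms by (auto simp: ratio intro!: prod_mono step)
  qed (use assms in auto)
qed

lemma sinh_of_real_complex: "sinh (complex_of_real x) = of_real (sinh x)"
  by (simp add: sinh_def exp_minus scaleR_conv_of_real exp_of_real)

text \<open>Conjugation turns the squared modulus into the product of Gamma at 1 + it and at 1 - it,
  which is one functional equation away from the reflection formula at
  \<open>\<i> * t\<close>.\<close>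

lemma norm_Gamma_one_plus_imag:
  fixes t :: real
  assumes "t \<noteq> 0"
  shows "(norm (Gamma (Complex 1 t)))\<^sup>2 = pi * t / sinh (pi * t)"
proof -
  define z where "z = \<i> * complex_of_real t"
  have nz: "z \<notin> \<int>\<^sub>\<le>\<^sub>0" using assms by (auto simp: z_def complex_eq_iff elim!: nonpos_Ints_cases)
  have c1: "Complex 1 t = z + 1" "cnj (Complex 1 t) = 1 - z" by (auto simp: z_def complex_eq_iff)
  have "complex_of_real ((norm (Gamma (Complex 1 t)))\<^sup>2) = Gamma (z + 1) * Gamma (1 - z)"
    unfolding complex_norm_square cnj_Gamma c1(2) unfolding c1(1) ..
  also have "\<dots> = z * (Gamma z * Gamma (1 - z))"
    using nz by (simp add: Gamma_plus1)
  also have "\<dots> = z * (of_real pi / sin (of_real pi * z))"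
    by (simp add: Gamma_reflection_complex)
  also have "sin (of_real pi * z) = \<i> * sinh (of_real (pi * t))"
    by (simp add: z_def sinh_conv_sin mult_ac)
  also have "sinh (complex_of_real (pi * t)) = of_real (sinh (pi * t))"
    by (rule sinh_of_real_complex)
  also have "z * (of_real pi / (\<i> * of_real (sinh (pi * t)))) = of_real (pi * t / sinh (pi * t))"
    by (simp add: z_def)
  finally show ?thesis using of_real_eq_iff by blast
qed

text \<open>
  The \<open>\<epsilon>\<close> absorbs powers of \<open>\<bar>Im s\<bar>\<close>, so the exponents simply add up in products.
\<close>

definition strip_bound :: "(complex \<Rightarrow> complex) \<Rightarrow> real \<Rightarrow> bool" where
  "strip_bound f \<tau> \<longleftrightarrow>
     (\<forall>a b \<epsilon>. \<epsilon> > 0 \<longrightarrow> (\<exists>C T. \<forall>s. a \<le> Re s \<and> Re s \<le> b \<and> T \<le> \<bar>Im s\<bar> \<longrightarrow>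
        norm (f s) \<le> C * exp ((\<tau> + \<epsilon>) * \<bar>Im s\<bar>)))"

text \<open>Enlarging \<open>C\<close> and \<open>T\<close> costs nothing, and a positive
  \<open>C\<close> is what lets two bounds be multiplied.\<close>

lemma strip_boundD:
  assumes "strip_bound f \<tau>" "\<tau> < \<sigma>"
  obtains C T where "C > 0" "T > 0" "\<And>s. a \<le> Re s \<Longrightarrow> Re s \<le> b \<Longrightarrow> T \<le> \<bar>Im s\<bar> \<Longrightarrow> norm (f s) \<le> C * exp (\<sigma> * \<bar>Im s\<bar>)"
proof -
  obtain C T where CT: "\<And>s. a \<le> Re s \<Longrightarrow> Re s \<le> b \<Longrightarrow> T \<le> \<bar>Im s\<bar> \<Longrightarrow> norm (f s) \<le> C * exp (\<sigma> * \<bar>Im s\<bar>)"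
    using assms(1)[unfolded strip_bound_def, rule_format, of "\<sigma> - \<tau>" a b] assms(2) by auto
  have "norm (f s) \<le> max C 1 * exp (\<sigma> * \<bar>Im s\<bar>)" if "a \<le> Re s" "Re s \<le> b" "max T 1 \<le> \<bar>Im s\<bar>" for s
  proof -
    have "norm (f s) \<le> C * exp (\<sigma> * \<bar>Im s\<bar>)" using CT that by simp
    also have "\<dots> \<le> max C 1 * exp (\<sigma> * \<bar>Im s\<bar>)" by (intro mult_right_mono) auto
    finally show ?thesis .
  qed
  then show ?thesis by (intro that[of "max C 1" "max T 1"]) auto
qed

lemma strip_boundI:
  assumes "\<And>a b \<sigma>. \<tau> < \<sigma> \<Longrightarrow> \<exists>C T. \<forall>s. a \<le> Re s \<and> Re s \<le> b \<and> T \<le> \<bar>Im s\<bar> \<longrightarrow>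
        norm (f s) \<le> C * exp (\<sigma> * \<bar>Im s\<bar>)"
  shows "strip_bound f \<tau>"
  unfolding strip_bound_def using assms by simp

section \<open>Products of strip bounds\<close>

lemma strip_bound_1: "strip_bound (\<lambda>s. 1) 0"
  by (rule strip_boundI) (auto intro!: exI[of _ 1])

lemma strip_bound_mult:
  assumes f: "strip_bound f \<tau>" and g: "strip_bound g \<sigma>"
  shows "strip_bound (\<lambda>s. f s * g s) (\<tau> + \<sigma>)"
proof (rule strip_boundI)
  fix a b \<rho> :: real assume "\<tau> + \<sigma> < \<rho>"
  \<comment> \<open>Half of the slack in the exponent goes to each factor.\<close>
  define d where "d = (\<rho> - \<tau> - \<sigma>) / 2"
  have d: "d > 0" "(\<tau> + d) + (\<sigma> + d) = \<rho>" using \<open>\<tau> + \<sigma> < \<rho>\<close> by (auto simp: d_def field_simps)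
  obtain C T where 1: "C > 0" "\<And>s. a \<le> Re s \<Longrightarrow> Re s \<le> b \<Longrightarrow> T \<le> \<bar>Im s\<bar> \<Longrightarrow> norm (f s) \<le> C * exp ((\<tau> + d) * \<bar>Im s\<bar>)"
    by (rule strip_boundD[OF f, of "\<tau> + d" a b]) (use d in auto)
  obtain D U where 2: "D > 0" "\<And>s. a \<le> Re s \<Longrightarrow> Re s \<le> b \<Longrightarrow> U \<le> \<bar>Im s\<bar> \<Longrightarrow> norm (g s) \<le> D * exp ((\<sigma> + d) * \<bar>Im s\<bar>)"
    by (rule strip_boundD[OF g, of "\<sigma> + d" a b]) (use d in auto)
  have "norm (f s * g s) \<le> (C * D) * exp (\<rho> * \<bar>Im s\<bar>)"
    if "a \<le> Re s" "Re s \<le> b" "max T U \<le> \<bar>Im s\<bar>" for s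
  proof -
    have "norm (f s * g s) \<le> (C * exp ((\<tau> + d) * \<bar>Im s\<bar>)) * (D * exp ((\<sigma> + d) * \<bar>Im s\<bar>))"
      unfolding norm_mult using that 1 2 by (intro mult_mono) auto
    also have "\<dots> = (C * D) * exp (\<rho> * \<bar>Im s\<bar>)"
      unfolding d(2)[symmetric] distrib_right[of "\<tau> + d" "\<sigma> + d"] exp_add by simp
    finally show ?thesis .
  qed
  then show "\<exists>C T. \<forall>s. a \<le> Re s \<and> Re s \<le> b \<and> T \<le> \<bar>Im s\<bar> \<longrightarrow> norm (f s * g s) \<le> C * exp (\<rho> * \<bar>Im s\<bar>)"
    by blast
qed

lemma strip_bound_mult0:
  assumes "strip_bound f \<tau>" "strip_bound g 0"
  shows "strip_bound (\<lambda>s. f s * g s) \<tau>"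
  using strip_bound_mult[OF assms] by simp

lemma strip_bound_prod0:
  assumes "\<And>k. k < (N::nat) \<Longrightarrow> strip_bound (f k) 0"
  shows "strip_bound (\<lambda>s. \<Prod>k<N. f k s) 0"
  using assms by (induction N) (auto simp: strip_bound_1 intro!: strip_bound_mult0)

lemma strip_bound_plus_const: "strip_bound (\<lambda>s. s + of_real c) 0"
proof (rule strip_boundI)
  fix a b \<sigma> :: real assume \<sigma>: "0 < \<sigma>"
  define K where "K = max \<bar>a + c\<bar> \<bar>b + c\<bar>"
  have "norm (s + of_real c) \<le> (K + 1 / \<sigma>) * exp (\<sigma> * \<bar>Im s\<bar>)"
    if "a \<le> Re s" "Re s \<le> b" for s
  proof -
    have "norm (s + of_real c) \<le> \<bar>Re s + c\<bar> + \<bar>Im s\<bar>"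
      using cmod_le[of "s + of_real c"] by simp
    moreover have "\<bar>Re s + c\<bar> \<le> K" using that by (auto simp: K_def)
    moreover have "K \<le> K * exp (\<sigma> * \<bar>Im s\<bar>)" using \<sigma> by (auto simp: K_def mult_le_cancel_left1)
    \<comment> \<open>From \<open>1 + y \<le> exp y\<close> at
      \<open>y = \<sigma> * \<bar>Im s\<bar>\<close>; this is the origin of the summand
      \<open>1 / \<sigma>\<close> in the constant.\<close>
    moreover have "\<bar>Im s\<bar> \<le> (1 / \<sigma>) * exp (\<sigma> * \<bar>Im s\<bar>)"
      using exp_ge_add_one_self[of "\<sigma> * \<bar>Im s\<bar>"] \<sigma>
      by (simp add: field_simps del: exp_ge_add_one_self)
    ultimately show ?thesis unfolding distrib_right by linarith
  qed
  then show "\<exists>C T. \<forall>s. a \<le> Re s \<and> Re s \<le> b \<and> T \<le> \<bar>Im s\<bar> \<longrightarrow> norm (s + of_real c) \<le> C * exp (\<sigma> * \<bar>Im s\<bar>)"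
    by blast
qed

text \<open>The pole at \<open>- c\<close> is real while strip bounds concern large heights only: at
  height at least 1 the denominator has modulus at least 1.\<close>

lemma strip_bound_inverse_plus_const: "strip_bound (\<lambda>s. inverse (s + of_real c)) 0"
proof (rule strip_boundI)
  fix a b \<sigma> :: real assume \<sigma>: "0 < \<sigma>"
  have "norm (inverse (s + of_real c)) \<le> 1 * exp (\<sigma> * \<bar>Im s\<bar>)" if "1 \<le> \<bar>Im s\<bar>" for s
  proof -
    have "1 \<le> norm (s + of_real c)" using abs_Im_le_cmod[of "s + of_real c"] that by simp
    then have "norm (inverse (s + of_real c)) \<le> 1" by (simp add: norm_inverse inverse_le_1_iff)
    also have "\<dots> \<le> 1 * exp (\<sigma> * \<bar>Im s\<bar>)" using \<sigma> by simp
    finally show ?thesis .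
  qed
  then show "\<exists>C T. \<forall>s. a \<le> Re s \<and> Re s \<le> b \<and> T \<le> \<bar>Im s\<bar> \<longrightarrow> norm (inverse (s + of_real c)) \<le> C * exp (\<sigma> * \<bar>Im s\<bar>)"
    by blast
qed

section \<open>Growth of Gamma on the line \<open>Re s = 1\<close>\<close>

lemma sinh_bounds:
  fixes y :: real assumes "1 \<le> y"
  shows "exp y / 4 \<le> sinh y" "sinh y \<le> exp y"
proof -
  have "2 \<le> exp y" using exp_ge_add_one_self[of y] assms by linarith
  moreover have "exp (-y) \<le> 1" using assms by simp
  ultimately have "exp (- y) \<le> exp y / 2" by linarith
  then show "exp y / 4 \<le> sinh y" by (simp add: sinh_def)
  show "sinh y \<le> exp y" using \<open>exp (- y) \<le> exp y / 2\<close> 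
    by (simp add: sinh_def) (smt (verit) exp_gt_zero)
qed

text \<open>Both are square roots of estimates for
  \<open>pi * \<bar>t\<bar> / sinh (pi * \<bar>t\<bar>)\<close>. Upwards,
  \<open>sinh y \<ge> exp y / 4\<close> leaves the factor \<open>4 * pi * \<bar>t\<bar>\<close>, and
  \<open>\<bar>t\<bar> \<le> exp (2 * \<epsilon> * \<bar>t\<bar>) / (2 * \<epsilon>)\<close> turns
  it into the constant \<open>2 * pi / \<epsilon>\<close>. Downwards,
  \<open>sinh y \<le> exp y\<close> and \<open>pi * \<bar>t\<bar> \<ge> 1\<close> suffice.\<close>

lemma norm_Gamma_one_plus_imag_bounds:
  fixes t \<epsilon> :: real
  assumes t: "1 \<le> \<bar>t\<bar>" and \<epsilon>: "\<epsilon> > 0"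
  shows "norm (Gamma (Complex 1 t)) \<le> sqrt (2 * pi / \<epsilon>) * exp ((- pi / 2 + \<epsilon>) * \<bar>t\<bar>)"
    and "1 \<le> norm (Gamma (Complex 1 t)) * exp (pi / 2 * \<bar>t\<bar>)"
proof -
  have pt: "1 \<le> pi * \<bar>t\<bar>" using mult_mono[of 1 pi 1 "\<bar>t\<bar>"] t pi_gt3 by simp
  have eq: "(norm (Gamma (Complex 1 t)))\<^sup>2 = pi * \<bar>t\<bar> / sinh (pi * \<bar>t\<bar>)"
    using norm_Gamma_one_plus_imag[of t] t by (auto simp: abs_if)
  have s0: "sinh (pi * \<bar>t\<bar>) > 0" using pt by simp
  have "2 * \<epsilon> * \<bar>t\<bar> \<le> exp (2 * \<epsilon> * \<bar>t\<bar>)"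
    using exp_ge_add_one_self[of "2 * \<epsilon> * \<bar>t\<bar>"] by linarith
  then have te: "\<bar>t\<bar> \<le> exp (2 * \<epsilon> * \<bar>t\<bar>) / (2 * \<epsilon>)" using \<epsilon> by (simp add: field_simps)
  have "pi * \<bar>t\<bar> / sinh (pi * \<bar>t\<bar>) \<le> pi * \<bar>t\<bar> / (exp (pi * \<bar>t\<bar>) / 4)"
    using sinh_bounds[OF pt] s0 by (intro divide_left_mono) auto
  also have "\<dots> = 4 * pi * \<bar>t\<bar> * exp (- (pi * \<bar>t\<bar>))" by (simp add: exp_minus field_simps)
  also have "\<dots> \<le> 4 * pi * (exp (2 * \<epsilon> * \<bar>t\<bar>) / (2 * \<epsilon>)) * exp (- (pi * \<bar>t\<bar>))"
    by (intro mult_right_mono mult_left_mono te) auto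
  also have "\<dots> = (2 * pi / \<epsilon>) * exp (2 * \<epsilon> * \<bar>t\<bar> - pi * \<bar>t\<bar>)"
    by (simp add: exp_diff exp_minus field_simps)
  also have "2 * \<epsilon> * \<bar>t\<bar> - pi * \<bar>t\<bar> = 2 * ((- pi / 2 + \<epsilon>) * \<bar>t\<bar>)" by (simp add: algebra_simps)
  also have "(2 * pi / \<epsilon>) * exp \<dots> = (sqrt (2 * pi / \<epsilon>) * exp ((- pi / 2 + \<epsilon>) * \<bar>t\<bar>))\<^sup>2"
    using \<epsilon> by (simp add: power_mult_distrib exp_double)
  finally show "norm (Gamma (Complex 1 t)) \<le> sqrt (2 * pi / \<epsilon>) * exp ((- pi / 2 + \<epsilon>) * \<bar>t\<bar>)"
    unfolding eq[symmetric] using \<epsilon> by (elim power2_le_imp_le) auto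
  have "1 / exp (pi * \<bar>t\<bar>) \<le> pi * \<bar>t\<bar> / sinh (pi * \<bar>t\<bar>)"
    using sinh_bounds[OF pt] s0 pt by (intro frac_le) auto
  then have "1\<^sup>2 \<le> (norm (Gamma (Complex 1 t)) * exp (pi / 2 * \<bar>t\<bar>))\<^sup>2"
    by (simp add: power_mult_distrib eq exp_double[symmetric] divide_le_eq)
  then show "1 \<le> norm (Gamma (Complex 1 t)) * exp (pi / 2 * \<bar>t\<bar>)"
    by (rule power2_le_imp_le) auto
qed

text \<open>\<open>Gamma_ratio_mono\<close> moves a point horizontally, so the majorants in a strip
  are values at the same height on a fixed vertical line.\<close>

lemma strip_bound_imag_part: "strip_bound f \<tau> \<Longrightarrow> strip_bound (\<lambda>s. f (Complex c (Im s))) \<tau>"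
proof (rule strip_boundI)
  fix a b \<sigma> :: real assume f: "strip_bound f \<tau>" and "\<tau> < \<sigma>"
  then obtain C T where CT: "\<And>s. c \<le> Re s \<Longrightarrow> Re s \<le> c \<Longrightarrow> T \<le> \<bar>Im s\<bar> \<Longrightarrow> norm (f s) \<le> C * exp (\<sigma> * \<bar>Im s\<bar>)"
    by (rule strip_boundD[of f \<tau> \<sigma> c c]) auto
  have "norm (f (Complex c (Im s))) \<le> C * exp (\<sigma> * \<bar>Im s\<bar>)" if "T \<le> \<bar>Im s\<bar>" for s
    using CT[of "Complex c (Im s)"] that by simp
  then show "\<exists>C T. \<forall>s. a \<le> Re s \<and> Re s \<le> b \<and> T \<le> \<bar>Im s\<bar> \<longrightarrow>
      norm (f (Complex c (Im s))) \<le> C * exp (\<sigma> * \<bar>Im s\<bar>)"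
    by blast
qed

text \<open>The majorant may depend on the strip, as the number of functional equations needed to
  shift the strip does.\<close>

lemma strip_bound_leI:
  assumes "\<And>a b. \<exists>K g T. K \<ge> 0 \<and> strip_bound g \<tau> \<and>
     (\<forall>s. a \<le> Re s \<and> Re s \<le> b \<and> T \<le> \<bar>Im s\<bar> \<longrightarrow> norm (f s) \<le> K * norm (g s))"
  shows "strip_bound f \<tau>"
proof (rule strip_boundI)
  fix a b \<sigma> :: real assume "\<tau> < \<sigma>"
  obtain K g T where K: "K \<ge> 0" "strip_bound g \<tau>"
    and le: "\<And>s. a \<le> Re s \<Longrightarrow> Re s \<le> b \<Longrightarrow> T \<le> \<bar>Im s\<bar> \<Longrightarrow> norm (f s) \<le> K * norm (g s)"
    using assms[of a b] by blast
  obtain C U where C: "\<And>s. a \<le> Re s \<Longrightarrow> Re s \<le> b \<Longrightarrow> U \<le> \<bar>Im s\<bar> \<Longrightarrow> norm (g s) \<le> C * exp (\<sigma> * \<bar>Im s\<bar>)"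
    using strip_boundD[OF K(2) \<open>\<tau> < \<sigma>\<close>, of a b] by metis
  have "norm (f s) \<le> (K * C) * exp (\<sigma> * \<bar>Im s\<bar>)" if "a \<le> Re s" "Re s \<le> b" "max T U \<le> \<bar>Im s\<bar>" for s
    using le[of s] mult_left_mono[OF C[of s] K(1)] that by (simp add: mult.assoc)
  then show "\<exists>C T. \<forall>s. a \<le> Re s \<and> Re s \<le> b \<and> T \<le> \<bar>Im s\<bar> \<longrightarrow> norm (f s) \<le> C * exp (\<sigma> * \<bar>Im s\<bar>)"
    by blast
qed

lemma strip_bound_pochhammer: "strip_bound (\<lambda>s. pochhammer s N) 0"
  using strip_bound_prod0[of N "\<lambda>k s. s + of_real (real k)", OF strip_bound_plus_const]
  by (simp add: pochhammer_prod atLeast0LessThan)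

lemma strip_bound_inverse_pochhammer: "strip_bound (\<lambda>s. inverse (pochhammer s N)) 0"
  using strip_bound_prod0[of N "\<lambda>k s. inverse (s + of_real (real k))", OF strip_bound_inverse_plus_const]
  by (simp add: pochhammer_prod atLeast0LessThan flip: prod_inversef)

lemma nonreal_notin_nonpos_Ints: "Im s \<noteq> 0 \<Longrightarrow> s \<notin> \<int>\<^sub>\<le>\<^sub>0"
  by (auto elim!: nonpos_Ints_cases)

text \<open>\<open>N\<close> applications of the functional equation carry the strip to the right of
  the line \<open>Re s = 1\<close>, where monotonicity is available. The line
  \<open>Re s = 1 + M\<close> lies beyond the shifted strip and is an integer translate of the line
  on which the reflection formula gives the exact modulus.\<close>

lemma shift_into_right_strip:
  fixes a b :: real
  obtains N M :: nat where "\<And>x. a \<le> x \<Longrightarrow> x \<le> b \<Longrightarrow> 1 \<le> x + N \<and> x + N \<le> 1 + M"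
proof -
  obtain N :: nat where "1 - a \<le> N" using real_arch_simple by blast
  moreover obtain M :: nat where "b + N - 1 \<le> M" using real_arch_simple by blast
  ultimately show ?thesis by (intro that[of N M]) auto
qed

text \<open>Monotonicity controls only the quotient by the real value \<open>Gamma x\<close>;
  compactness removes this value at the cost of a constant.\<close>

lemma Gamma_real_bounds:
  obtains m K :: real where "m > 0" "K > 0" "\<And>x. 1 \<le> x \<Longrightarrow> x \<le> b \<Longrightarrow> m \<le> Gamma x \<and> Gamma x \<le> K"
proof -
  have cont: "continuous_on {1..b} (Gamma :: real \<Rightarrow> real)"
    by (intro continuous_on_Gamma) (auto elim!: nonpos_Ints_cases)
  show ?thesis
  proof (cases "1 \<le> b")
    case False then show ?thesis using that[of 1 1] by auto
  next
    case True
    then have ne: "{1..b} \<noteq> {}" by auto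
    obtain p where p: "p \<in> {1..b}" "\<And>x. x \<in> {1..b} \<Longrightarrow> Gamma p \<le> Gamma x"
      using continuous_attains_inf[OF compact_Icc ne cont] by blast
    obtain q where q: "q \<in> {1..b}" "\<And>x. x \<in> {1..b} \<Longrightarrow> Gamma x \<le> Gamma q"
      using continuous_attains_sup[OF compact_Icc ne cont] by blast
    have "Gamma p > 0" "Gamma q > 0" using p(1) q(1) by auto
    with p(2) q(2) show ?thesis by (intro that[of "Gamma p" "Gamma q"]) auto
  qed
qed

lemma strip_bound_Gamma_vertical:
  "strip_bound (\<lambda>s. Gamma (Complex 1 (Im s))) (- pi / 2)"
  "strip_bound (\<lambda>s. inverse (Gamma (Complex 1 (Im s)))) (pi / 2)"
proof -
  show "strip_bound (\<lambda>s. Gamma (Complex 1 (Im s))) (- pi / 2)"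
    unfolding strip_bound_def
  proof (intro allI impI)
    fix a b \<epsilon> :: real assume "\<epsilon> > 0"
    then have "\<forall>s. a \<le> Re s \<and> Re s \<le> b \<and> 1 \<le> \<bar>Im s\<bar> \<longrightarrow> norm (Gamma (Complex 1 (Im s))) \<le>
        sqrt (2 * pi / \<epsilon>) * exp ((- pi / 2 + \<epsilon>) * \<bar>Im s\<bar>)"
      using norm_Gamma_one_plus_imag_bounds(1) by blast
    then show "\<exists>C T. \<forall>s. a \<le> Re s \<and> Re s \<le> b \<and> T \<le> \<bar>Im s\<bar> \<longrightarrow> norm (Gamma (Complex 1 (Im s))) \<le>
        C * exp ((- pi / 2 + \<epsilon>) * \<bar>Im s\<bar>)" by blast
  qed
  show "strip_bound (\<lambda>s. inverse (Gamma (Complex 1 (Im s)))) (pi / 2)"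
  proof (rule strip_boundI)
    fix a b \<sigma> :: real assume \<sigma>: "pi / 2 < \<sigma>"
    have "norm (inverse (Gamma (Complex 1 (Im s)))) \<le> 1 * exp (\<sigma> * \<bar>Im s\<bar>)" if "1 \<le> \<bar>Im s\<bar>" for s
    proof -
      have "Gamma (Complex 1 (Im s)) \<noteq> 0" using that by (auto simp: Gamma_eq_zero_iff nonreal_notin_nonpos_Ints)
      then have "norm (inverse (Gamma (Complex 1 (Im s)))) \<le> exp (pi / 2 * \<bar>Im s\<bar>)"
        using norm_Gamma_one_plus_imag_bounds(2)[OF that, of 1]
        by (simp add: norm_inverse norm_divide field_simps)
      also have "\<dots> \<le> exp (\<sigma> * \<bar>Im s\<bar>)"
        unfolding exp_le_cancel_iff using \<sigma> by (intro mult_right_mono) auto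
      finally show ?thesis by simp
    qed
    then show "\<exists>C T. \<forall>s. a \<le> Re s \<and> Re s \<le> b \<and> T \<le> \<bar>Im s\<bar> \<longrightarrow>
        norm (inverse (Gamma (Complex 1 (Im s)))) \<le> C * exp (\<sigma> * \<bar>Im s\<bar>)"
      by blast
  qed
qed

text \<open>An upper bound uses monotonicity towards the right: after the shift by \<open>N\<close>,
  compare with the line \<open>Re s = 1 + M\<close>, and return from there to
  \<open>Re s = 1\<close> by \<open>M\<close> functional equations. The two Pochhammer factors are
  rational in their argument and contribute exponent 0.\<close>

lemma strip_bound_Gamma: "strip_bound Gamma (- pi / 2)"
proof (rule strip_bound_leI)
  fix a b :: real
  obtain N M :: nat where NM: "\<And>x. a \<le> x \<Longrightarrow> x \<le> b \<Longrightarrow> 1 \<le> x + N \<and> x + N \<le> 1 + M"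
    by (rule shift_into_right_strip[of a b]) auto
  obtain m K where mK: "m > 0" "K > 0" "\<And>x. 1 \<le> x \<Longrightarrow> x \<le> 1 + real M \<Longrightarrow> m \<le> Gamma x \<and> Gamma x \<le> K"
    by (rule Gamma_real_bounds[of "1 + real M"]) auto
  define g where "g s = Gamma (Complex 1 (Im s)) * (pochhammer (Complex 1 (Im s)) M * inverse (pochhammer s N))"
    for s
  have "strip_bound g (- pi / 2)"
    unfolding g_def
    by (intro strip_bound_mult0 strip_bound_Gamma_vertical strip_bound_inverse_pochhammer
          strip_bound_imag_part[of "\<lambda>s. pochhammer s M"] strip_bound_pochhammer)
  moreover have "norm (Gamma s) \<le> (K / m) * norm (g s)" if s: "a \<le> Re s" "Re s \<le> b" "1 \<le> \<bar>Im s\<bar>" for s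
  proof -
    have x: "1 \<le> Re s + N" "Re s + N \<le> 1 + M" using NM s by auto
    have "s \<notin> \<int>\<^sub>\<le>\<^sub>0" "Complex 1 (Im s) \<notin> \<int>\<^sub>\<le>\<^sub>0" using s by (auto intro!: nonreal_notin_nonpos_Ints)
    have 1: "Gamma s = Gamma (Complex (Re s + N) (Im s)) * inverse (pochhammer s N)"
    proof -
      have "Complex (Re s + N) (Im s) = s + of_nat N" by (simp add: complex_eq_iff)
      then show ?thesis using pochhammer_rGamma[of s N]
        by (simp add: Gamma_def)
    qed
    have 2: "Gamma (Complex (1 + real M) (Im s)) = Gamma (Complex 1 (Im s)) * pochhammer (Complex 1 (Im s)) M"
    proof -
      have "Complex (1 + M) (Im s) = Complex 1 (Im s) + of_nat M" by (simp add: complex_eq_iff)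
      then show ?thesis using pochhammer_Gamma[OF \<open>Complex 1 (Im s) \<notin> \<int>\<^sub>\<le>\<^sub>0\<close>, of M] \<open>Complex 1 (Im s) \<notin> \<int>\<^sub>\<le>\<^sub>0\<close>
        by (simp add: Gamma_eq_zero_iff)
    qed
    have "norm (Gamma (Complex (Re s + N) (Im s))) / Gamma (Re s + N)
        \<le> norm (Gamma (Complex (1 + M) (Im s))) / Gamma (1 + M)"
      using x by (intro Gamma_ratio_mono) auto
    then have "norm (Gamma (Complex (Re s + N) (Im s)))
        \<le> Gamma (Re s + N) * (norm (Gamma (Complex (1 + M) (Im s))) / Gamma (1 + M))"
      using x by (simp add: field_simps)
    also have "\<dots> \<le> K * (norm (Gamma (Complex (1 + M) (Im s))) / m)"
      using x mK by (intro mult_mono divide_left_mono) auto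
    also have "norm (Gamma (Complex (1 + M) (Im s)))
        = norm (Gamma (Complex 1 (Im s))) * norm (pochhammer (Complex 1 (Im s)) M)"
      using 2 by (simp add: norm_mult)
    finally have "norm (Gamma (Complex (Re s + N) (Im s))) * norm (inverse (pochhammer s N))
        \<le> K * (norm (Gamma (Complex 1 (Im s))) * norm (pochhammer (Complex 1 (Im s)) M) / m)
            * norm (inverse (pochhammer s N))"
      by (rule mult_right_mono) simp
    then show ?thesis
      unfolding 1 g_def norm_mult by (simp add: ac_simps)
  qed
  ultimately show "\<exists>K g T. K \<ge> 0 \<and> strip_bound g (- pi / 2) \<and>
     (\<forall>s. a \<le> Re s \<and> Re s \<le> b \<and> T \<le> \<bar>Im s\<bar> \<longrightarrow> norm (Gamma s) \<le> K * norm (g s))"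
    using mK by (intro exI[of _ "K / m"] exI[of _ g] exI[of _ 1]) auto
qed

text \<open>A lower bound for Gamma uses monotonicity towards the left, so the comparison line is
  \<open>Re s = 1\<close> itself and only the shift by \<open>N\<close> leaves a Pochhammer
  factor.\<close>

lemma strip_bound_rGamma: "strip_bound rGamma (pi / 2)"
proof (rule strip_bound_leI)
  fix a b :: real
  obtain N M :: nat where NM: "\<And>x. a \<le> x \<Longrightarrow> x \<le> b \<Longrightarrow> 1 \<le> x + N \<and> x + N \<le> 1 + M"
    by (rule shift_into_right_strip[of a b]) auto
  obtain m K where mK: "m > 0" "K > 0" "\<And>x. 1 \<le> x \<Longrightarrow> x \<le> 1 + real M \<Longrightarrow> m \<le> Gamma x \<and> Gamma x \<le> K"
    by (rule Gamma_real_bounds[of "1 + real M"]) auto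
  define g where "g s = inverse (Gamma (Complex 1 (Im s))) * pochhammer s N" for s
  have "strip_bound g (pi / 2)"
    unfolding g_def
    by (intro strip_bound_mult0 strip_bound_Gamma_vertical strip_bound_pochhammer)
  moreover have "norm (rGamma s) \<le> (1 / m) * norm (g s)" if s: "a \<le> Re s" "Re s \<le> b" "1 \<le> \<bar>Im s\<bar>" for s
  proof -
    have x: "1 \<le> Re s + N" "Re s + N \<le> 1 + M" using NM s by auto
    have 1: "rGamma s = pochhammer s N * inverse (Gamma (Complex (Re s + N) (Im s)))"
    proof -
      have "Complex (Re s + N) (Im s) = s + of_nat N" by (simp add: complex_eq_iff)
      then show ?thesis using pochhammer_rGamma[of s N] by (simp add: Gamma_def)
    qed
    have "Complex 1 (Im s) \<notin> \<int>\<^sub>\<le>\<^sub>0" using s by (auto intro!: nonreal_notin_nonpos_Ints)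
    then have pos: "norm (Gamma (Complex 1 (Im s))) > 0" by (simp add: Gamma_eq_zero_iff)
    have "norm (Gamma (Complex 1 (Im s))) / Gamma 1
        \<le> norm (Gamma (Complex (Re s + N) (Im s))) / Gamma (Re s + N)"
      using x by (intro Gamma_ratio_mono) auto
    also have "\<dots> \<le> norm (Gamma (Complex (Re s + N) (Im s))) / m"
      using x mK by (intro divide_left_mono) auto
    finally have "m * norm (Gamma (Complex 1 (Im s))) \<le> norm (Gamma (Complex (Re s + N) (Im s)))"
      using mK by (simp add: field_simps)
    then have "inverse (norm (Gamma (Complex (Re s + N) (Im s)))) \<le> inverse (m * norm (Gamma (Complex 1 (Im s))))"
      using mK pos by (intro le_imp_inverse_le) auto
    then have "norm (pochhammer s N) * inverse (norm (Gamma (Complex (Re s + N) (Im s))))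
        \<le> norm (pochhammer s N) * inverse (m * norm (Gamma (Complex 1 (Im s))))"
      by (rule mult_left_mono) simp
    then show ?thesis
      by (simp add: 1 g_def norm_mult norm_inverse divide_inverse ac_simps)
  qed
  ultimately show "\<exists>K g T. K \<ge> 0 \<and> strip_bound g (pi / 2) \<and>
     (\<forall>s. a \<le> Re s \<and> Re s \<le> b \<and> T \<le> \<bar>Im s\<bar> \<longrightarrow> norm (rGamma s) \<le> K * norm (g s))"
    using mK by (intro exI[of _ "1 / m"] exI[of _ g] exI[of _ 1]) auto
qed

text \<open>A real affine map sends strips to strips and multiplies heights by
  \<open>\<bar>B\<bar>\<close>. Negative \<open>B\<close> occurs in the factors with argument
  \<open>1 - \<alpha> - A * s\<close>.\<close>

lemma strip_bound_affine:
  assumes f: "strip_bound f \<tau>" and B: "B \<noteq> 0"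
  shows "strip_bound (\<lambda>s. f (of_real \<beta> + of_real B * s)) (\<bar>B\<bar> * \<tau>)"
proof (rule strip_boundI)
  fix a b \<sigma> :: real assume "\<bar>B\<bar> * \<tau> < \<sigma>"
  then have "\<tau> < \<sigma> / \<bar>B\<bar>" using B by (simp add: field_simps)
  define K where "K = \<bar>\<beta>\<bar> + \<bar>B\<bar> * (\<bar>a\<bar> + \<bar>b\<bar>)"
  obtain C T where C: "\<And>s. -K \<le> Re s \<Longrightarrow> Re s \<le> K \<Longrightarrow> T \<le> \<bar>Im s\<bar> \<Longrightarrow> norm (f s) \<le> C * exp (\<sigma> / \<bar>B\<bar> * \<bar>Im s\<bar>)"
    using strip_boundD[OF f \<open>\<tau> < \<sigma> / \<bar>B\<bar>\<close>, of "-K" K] by metis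
  have "norm (f (of_real \<beta> + of_real B * s)) \<le> C * exp (\<sigma> * \<bar>Im s\<bar>)"
    if s: "a \<le> Re s" "Re s \<le> b" "T / \<bar>B\<bar> \<le> \<bar>Im s\<bar>" for s
  proof -
    have "\<bar>\<beta> + B * Re s\<bar> \<le> \<bar>\<beta>\<bar> + \<bar>B\<bar> * \<bar>Re s\<bar>" by (metis abs_mult abs_triangle_ineq)
    also have "\<dots> \<le> K" unfolding K_def using s by (intro add_left_mono mult_left_mono) auto
    finally have "\<bar>\<beta> + B * Re s\<bar> \<le> K" .
    moreover have "T \<le> \<bar>B * Im s\<bar>" using s B by (simp add: abs_mult field_simps)
    ultimately have "norm (f (of_real \<beta> + of_real B * s)) \<le> C * exp (\<sigma> / \<bar>B\<bar> * \<bar>B * Im s\<bar>)"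
      using C[of "of_real \<beta> + of_real B * s"] by auto
    then show ?thesis using B by (simp add: abs_mult)
  qed
  then show "\<exists>C T. \<forall>s. a \<le> Re s \<and> Re s \<le> b \<and> T \<le> \<bar>Im s\<bar> \<longrightarrow>
      norm (f (of_real \<beta> + of_real B * s)) \<le> C * exp (\<sigma> * \<bar>Im s\<bar>)"
    by blast
qed

section \<open>Winding numbers of vertical contours\<close>

lemma vertical_contour_continuous:
  assumes "vertical_contour \<gamma> c"
  shows "continuous_on UNIV c"
proof -
  obtain R where R: "R > 0" "c piecewise_C1_differentiable_on {-R..R}" "\<And>t. \<bar>t\<bar> \<ge> R \<Longrightarrow> c t = Complex \<gamma> t"
    using assms by (auto simp: vertical_contour_def)
  have mid: "continuous_on {-R..R} c" using R(2) by (simp add: piecewise_C1_differentiable_on_def)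
  have "continuous_on ({..-R} \<union> {R..}) (\<lambda>t. Complex \<gamma> t)"
    by (intro continuous_intros)
  then have tails: "continuous_on ({..-R} \<union> {R..}) c"
    by (rule continuous_on_eq) (use R in auto)
  have "continuous_on ({-R..R} \<union> ({..-R} \<union> {R..})) c"
    by (rule continuous_on_closed_Un) (auto simp: mid tails)
  moreover have "{-R..R} \<union> ({..-R} \<union> {R..}) = UNIV" using R(1) by auto
  ultimately show ?thesis by simp
qed

lemma vertical_contour_bounded_Re:
  assumes "vertical_contour \<gamma> c"
  obtains K where "K > 0" "\<And>t. \<bar>Re (c t)\<bar> < K"
proof -
  obtain R where R: "R > 0" "\<And>t. \<bar>t\<bar> \<ge> R \<Longrightarrow> c t = Complex \<gamma> t"
    using assms by (auto simp: vertical_contour_def)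
  have "compact (c ` {-R..R})"
    by (intro compact_continuous_image continuous_on_subset[OF vertical_contour_continuous[OF assms]]) auto
  then obtain B where B: "\<And>t. t \<in> {-R..R} \<Longrightarrow> norm (c t) \<le> B"
    by (meson bounded_iff compact_imp_bounded image_eqI)
  have "\<bar>Re (c t)\<bar> < \<bar>B\<bar> + \<bar>\<gamma>\<bar> + 1" for t
  proof (cases "\<bar>t\<bar> \<ge> R")
    case False
    then have "norm (c t) \<le> B" by (intro B) auto
    then show ?thesis using abs_Re_le_cmod[of "c t"] by linarith
  qed (simp add: R)
  then show ?thesis by (intro that[of "\<bar>B\<bar> + \<bar>\<gamma>\<bar> + 1"]) auto
qed

text \<open>A compact middle part and two closed rays. The complement is thus open, its components
  are path components, and a point can be joined to a far real number by an actual path.\<close>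

lemma vertical_contour_closed_range:
  assumes "vertical_contour \<gamma> c"
  shows "closed (range c)"
proof -
  obtain R where R: "R > 0" "\<And>t. \<bar>t\<bar> \<ge> R \<Longrightarrow> c t = Complex \<gamma> t"
    using assms by (auto simp: vertical_contour_def)
  have "range c = c ` {-R..R} \<union> ({z. Re z = \<gamma>} \<inter> ({z. Im z \<ge> R} \<union> {z. Im z \<le> -R}))" (is "_ = ?A")
  proof
    show "range c \<subseteq> ?A"
    proof
      fix z assume "z \<in> range c"
      then obtain t where t: "z = c t" by auto
      show "z \<in> ?A"
      proof (cases "\<bar>t\<bar> \<ge> R")
        case True then show ?thesis using R by (auto simp: t)
      next
        case False then have "t \<in> {-R..R}" by auto
        then show ?thesis unfolding t by blast
      qed
    qed
    show "?A \<subseteq> range c"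
    proof -
      have "z \<in> range c" if "Re z = \<gamma>" "\<bar>Im z\<bar> \<ge> R" for z
        using R(2)[OF that(2)] that(1) by (metis complex.collapse rangeI)
      then show ?thesis by force
    qed
  qed
  moreover have "compact (c ` {-R..R})"
    by (intro compact_continuous_image continuous_on_subset[OF vertical_contour_continuous[OF assms]]) auto
  ultimately show ?thesis
    by (simp only:) (intro closed_Un closed_Int compact_imp_closed closed_Collect_le closed_Collect_eq
        continuous_intros)
qed

section \<open>Finite pieces of a contour as paths on the unit interval\<close>

definition truncated :: "(real \<Rightarrow> complex) \<Rightarrow> real \<Rightarrow> real \<Rightarrow> complex" where
  "truncated c R = c \<circ> (\<lambda>u. (2 * R) *\<^sub>R u + (- R))"

lemma truncated_simps [simp]:
  "pathstart (truncated c R) = c (- R)"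
  "pathfinish (truncated c R) = c R"
  by (simp_all add: truncated_def pathstart_def pathfinish_def)

lemma truncated_image:
  fixes R :: real
  assumes "R > 0"
  shows "(\<lambda>u. (2 * R) * u + (- R)) ` {0..1} = {-R..R}"
  using image_affinity_atLeastAtMost[of "2 * R" "-R" 0 1] assms by (auto simp: algebra_simps)

lemma path_image_truncated:
  assumes "R > 0"
  shows "path_image (truncated c R) = c ` {-R..R}"
  using truncated_image[OF assms] unfolding path_image_def truncated_def
  by (metis (no_types, lifting) image_comp image_cong real_scaleR_def)

lemma vertical_contour_tail_derivative:
  assumes "\<And>t. \<bar>t\<bar> \<ge> T \<Longrightarrow> c t = Complex \<gamma> t" "\<bar>t\<bar> > T"
  shows "(c has_vector_derivative \<i>) (at t)"
proof -
  have op: "open ({..<-T} \<union> {T<..})" by auto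
  have "((\<lambda>t. Complex \<gamma> t) has_vector_derivative \<i>) (at t)"
    unfolding Complex_eq by (auto intro!: derivative_eq_intros)
  then show ?thesis
    by (rule has_vector_derivative_transform_within_open[OF _ op]) (use assms in auto)
qed

text \<open>Piecewise smoothness is granted on one interval only. Beyond it the curve is a vertical
  line, so for a larger interval just the two junction points join the exceptional set.\<close>

lemma vertical_contour_piecewise:
  assumes "vertical_contour \<gamma> c"
  obtains T where "T > 0" "\<And>t. \<bar>t\<bar> \<ge> T \<Longrightarrow> c t = Complex \<gamma> t"
    "\<And>R. R \<ge> T \<Longrightarrow> c piecewise_C1_differentiable_on {-R..R}"
proof -
  obtain T where T: "T > 0" "c piecewise_C1_differentiable_on {-T..T}" "\<And>t. \<bar>t\<bar> \<ge> T \<Longrightarrow> c t = Complex \<gamma> t"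
    using assms by (auto simp: vertical_contour_def)
  have "c piecewise_C1_differentiable_on {-R..R}" if R: "R \<ge> T" for R
  proof -
    obtain F where F: "finite F" "c C1_differentiable_on {-T..T} - F"
      using T(2) by (auto simp: piecewise_C1_differentiable_on_def)
    obtain D where D: "\<And>x. x \<in> {-T..T} - F \<Longrightarrow> (c has_vector_derivative D x) (at x)"
        "continuous_on ({-T..T} - F) D"
      using F(2) unfolding C1_differentiable_on_def by metis
    have out: "(c has_vector_derivative \<i>) (at x)" if "\<bar>x\<bar> > T" for x
      using T(3) that by (rule vertical_contour_tail_derivative)
    define D' where "D' x = (if x \<in> {-T<..<T} then D x else \<i>)" for x
    have der: "(c has_vector_derivative D' x) (at x)" if "x \<in> UNIV - (F \<union> {-T, T})" for x
    proof (cases "x \<in> {-T<..<T}")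
      case True then show ?thesis using D(1)[of x] that by (auto simp: D'_def)
    next
      case False then show ?thesis using out[of x] that by (auto simp: D'_def)
    qed
    have cont: "continuous_on (UNIV - (F \<union> {-T, T})) D'"
    proof -
      have "continuous_on ({-T<..<T} - F) D'"
        by (rule continuous_on_eq[OF continuous_on_subset[OF D(2)]]) (auto simp: D'_def)
      moreover have "continuous_on (({..<-T} \<union> {T<..}) - F) D'"
        by (rule continuous_on_eq[of _ "\<lambda>_. \<i>"]) (auto simp: D'_def)
      moreover have "open ({-T<..<T} - F)" "open (({..<-T} \<union> {T<..}) - F)"
        using F(1) by (auto intro!: open_Diff finite_imp_closed)
      ultimately have "continuous_on (({-T<..<T} - F) \<union> (({..<-T} \<union> {T<..}) - F)) D'"
        by (intro continuous_on_open_Un)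
      moreover have "({-T<..<T} - F) \<union> (({..<-T} \<union> {T<..}) - F) = UNIV - (F \<union> {-T, T})"
        using T(1) by auto
      ultimately show ?thesis by simp
    qed
    have "c C1_differentiable_on (UNIV - (F \<union> {-T, T}))"
      unfolding C1_differentiable_on_def using der cont by blast
    then show ?thesis
      unfolding piecewise_C1_differentiable_on_def
      using F(1) continuous_on_subset[OF vertical_contour_continuous[OF assms]]
      by (meson C1_differentiable_on_subset Diff_mono finite.emptyI finite.insertI finite_UnI order_refl subset_UNIV)
  qed
  with T show ?thesis by (intro that)
qed

lemma path_truncated: "vertical_contour \<gamma> c \<Longrightarrow> path (truncated c R)"
  unfolding truncated_def path_def
  by (intro continuous_on_compose continuous_intros continuous_on_subset[OF vertical_contour_continuous]) auto

lemma valid_path_truncated: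
  assumes "R > 0" "c piecewise_C1_differentiable_on {-R..R}"
  shows "valid_path (truncated c R)"
  unfolding valid_path_def truncated_def
  by (rule piecewise_C1_differentiable_affine) (use assms truncated_image in simp)

text \<open>This is the substitution \<open>t = 2 * R * u - R\<close>. The chain rule may fail at
  the parameters where \<open>c\<close> is not differentiable, but these form a finite and hence
  negligible set.\<close>

lemma has_contour_integral_truncated:
  assumes R: "R > 0" and c: "c piecewise_C1_differentiable_on {-R..R}"
    and I: "(f has_contour_integral I) (truncated c R)"
  shows "((\<lambda>t. f (c t) * vector_derivative c (at t)) has_integral I) {-R..R}"
proof -
  define h where "h t = f (c t) * vector_derivative c (at t)" for t
  obtain F where F: "finite F" "c C1_differentiable_on {-R..R} - F"
    using c by (auto simp: piecewise_C1_differentiable_on_def)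
  have "((\<lambda>u. f (truncated c R u) * vector_derivative (truncated c R) (at u)) has_integral I) {0..1}"
    using I by (simp add: has_contour_integral)
  then have "((\<lambda>u. of_real (2 * R) * h ((2 * R) *\<^sub>R u + (- R))) has_integral I) {0..1}"
  proof (rule has_integral_spike[rotated 2])
    show "negligible ((\<lambda>t. (t + R) / (2 * R)) ` F)" using F(1) by (intro negligible_finite) auto
    fix u assume u: "u \<in> {0..1} - (\<lambda>t. (t + R) / (2 * R)) ` F"
    define t where "t = (2 * R) * u + (- R)"
    have "u = (t + R) / (2 * R)" using R by (simp add: t_def)
    then have "t \<notin> F" using u by auto
    moreover have "t \<in> {-R..R}" using u R truncated_image[OF R] by (auto simp: t_def)
    ultimately obtain D where D: "(c has_vector_derivative D) (at t)"
      using F(2) unfolding C1_differentiable_on_def by blast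
    have "((\<lambda>u. (2 * R) *\<^sub>R u + (- R)) has_vector_derivative (2 * R)) (at u)"
      by (auto intro!: derivative_eq_intros simp flip: has_real_derivative_iff_has_vector_derivative)
    from vector_diff_chain_at[OF this, of c D] D
    have "(truncated c R has_vector_derivative (2 * R) *\<^sub>R D) (at u)"
      by (simp add: truncated_def t_def)
    then show "of_real (2 * R) * h ((2 * R) *\<^sub>R u + (- R))
        = f (truncated c R u) * vector_derivative (truncated c R) (at u)"
      using D by (simp add: vector_derivative_at h_def truncated_def t_def scaleR_conv_of_real)
  qed
  from has_integral_mult_right[OF this, of "inverse (of_real (2 * R))"] R
  have "((\<lambda>u. h ((2 * R) *\<^sub>R u + (- R))) has_integral (I /\<^sub>R (2 * R))) {0..1}"
    by (simp add: scaleR_conv_of_real mult.assoc [symmetric])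
  then show ?thesis
    using has_integral_affinity_iff[of "2 * R" h "-R" I "-R" R] R by (simp flip: h_def)
qed

text \<open>
  The half-plane \<open>H\<close> contains the contour and the three segments that close it up far away on the
  side of the vertical line \<open>Re s = X\<close>, but not the point \<open>x\<close> to which \<open>w\<close> can be connected.
\<close>

lemma closed_up_winding_number:
  assumes c: "vertical_contour \<gamma> c" and H: "convex H" "x \<notin> H" "range c \<subseteq> H"
    and wx: "path_component (- range c) w x"
  obtains B where "\<And>R X. B \<le> R \<Longrightarrow> B \<le> \<bar>X\<bar> \<Longrightarrow> (\<And>y. Complex X y \<in> H) \<Longrightarrow>
     winding_number (truncated c R) w + winding_number (linepath (Complex \<gamma> R) (Complex X R)) w
     + winding_number (linepath (Complex X R) (Complex X (-R))) w
     + winding_number (linepath (Complex X (-R)) (Complex \<gamma> (-R))) w = 0"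
proof -
  obtain g where g: "path g" "path_image g \<subseteq> - range c" "pathstart g = w" "pathfinish g = x"
    using wx by (auto simp: path_component_def)
  obtain B0 where B0: "\<And>z. z \<in> path_image g \<Longrightarrow> norm z \<le> B0"
    using bounded_path_image[OF g(1)] by (auto simp: bounded_iff)
  obtain T where T: "T > 0" "\<And>t. \<bar>t\<bar> \<ge> T \<Longrightarrow> c t = Complex \<gamma> t"
    using c by (auto simp: vertical_contour_def)
  have main: "winding_number (truncated c R) w + winding_number (linepath (Complex \<gamma> R) (Complex X R)) w
     + winding_number (linepath (Complex X R) (Complex X (-R))) w
     + winding_number (linepath (Complex X (-R)) (Complex \<gamma> (-R))) w = 0"
    if R: "max (B0 + 1) T \<le> R" and X: "max (B0 + 1) T \<le> \<bar>X\<bar>" and XH: "\<And>y. Complex X y \<in> H" for R X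
  proof -
    have R0: "R > 0" "R > B0" "\<bar>X\<bar> > B0" using R X T by auto
    define l1 where "l1 = linepath (Complex \<gamma> R) (Complex X R)"
    define l2 where "l2 = linepath (Complex X R) (Complex X (-R))"
    define l3 where "l3 = linepath (Complex X (-R)) (Complex \<gamma> (-R))"
    define L where "L = truncated c R +++ l1 +++ l2 +++ l3"
    have ends: "c R = Complex \<gamma> R" "c (-R) = Complex \<gamma> (-R)" using R T by auto
    then have endsH: "Complex \<gamma> R \<in> H" "Complex \<gamma> (-R) \<in> H" using H(3) by (metis range_subsetD)+
    have pt: "path (truncated c R)" by (rule path_truncated[OF c])
    have L: "path L" "pathstart L = pathfinish L"
      using pt by (simp_all add: L_def l1_def l2_def l3_def ends)
    have img: "path_image L = c ` {-R..R} \<union> path_image l1 \<union> path_image l2 \<union> path_image l3"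
      by (simp add: L_def l1_def l2_def l3_def ends path_image_join path_image_truncated R0 Un_assoc)
    have "path_image L \<subseteq> H"
      unfolding img l1_def l2_def l3_def using H endsH XH
      by (auto simp: closed_segment_subset intro: subsetD[OF closed_segment_subset])
    then have zero: "winding_number L x = 0"
      using L H by (intro winding_number_zero_outside[of L H]) auto
    have im: "\<bar>Im z\<bar> = R \<or> \<bar>Re z\<bar> = \<bar>X\<bar>" if "z \<in> path_image l1 \<union> path_image l2 \<union> path_image l3" for z
      using that R0(1) unfolding l1_def l2_def l3_def
      by (auto simp: in_segment complex_eq_iff algebra_simps)
    \<comment> \<open>The path \<open>g\<close> stays in the disc of radius \<open>B0\<close>,
      whereas every point of the three segments has \<open>\<bar>Im z\<bar> = R\<close> or
      \<open>\<bar>Re z\<bar> = \<bar>X\<bar>\<close>, both larger than \<open>B0\<close>.\<close>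
    have disj: "path_image g \<inter> path_image L = {}"
    proof -
      have "z \<notin> path_image L" if z: "z \<in> path_image g" for z
      proof -
        have "\<bar>Im z\<bar> < R" "\<bar>Re z\<bar> < \<bar>X\<bar>"
          using B0[OF z] abs_Im_le_cmod[of z] abs_Re_le_cmod[of z] R0 by linarith+
        then show ?thesis using im[of z] g(2) z unfolding img by fastforce
      qed
      then show ?thesis by blast
    qed
    have wxg: "w \<in> path_image g" "x \<in> path_image g"
      using g(3,4) pathstart_in_path_image pathfinish_in_path_image by blast+
    have "winding_number L w = winding_number L x"
      by (rule winding_number_eq[OF L(1) L(2)[symmetric] wxg connected_path_image[OF g(1)] disj])
    with zero have "winding_number L w = 0" by simp
    moreover have nin: "w \<notin> path_image (truncated c R)" "w \<notin> path_image l1" "w \<notin> path_image l2" "w \<notin> path_image l3"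
      using disj wxg unfolding img path_image_truncated[OF R0(1)] by auto
    moreover have "winding_number L w = winding_number (truncated c R) w + (winding_number l1 w
        + (winding_number l2 w + winding_number l3 w))"
      using nin unfolding L_def l1_def l2_def l3_def
      by (simp add: winding_number_join pt ends path_image_join del: path_image_linepath)
    ultimately show ?thesis by (simp add: l1_def l2_def l3_def add.assoc)
  qed
  show ?thesis by (rule that[of "max (B0 + 1) T"]) (rule main)
qed

section \<open>Winding numbers of the loop between two contours\<close>

lemma Im_horizontal_segment: "z \<in> closed_segment (Complex a y) (Complex b y) \<Longrightarrow> Im z = y"
  using closed_segment_subset[of "Complex a y" "{z. Im z = y}" "Complex b y"] convex_hyperplane[of \<i> y]
  by auto

text \<open>The degenerate triangle lies on a line, a convex set without \<open>w\<close>.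
  Horizontal edges can therefore be recombined whatever the order of the abscissae.\<close>

lemma winding_number_collinear_triangle:
  assumes "Im w \<noteq> y"
  shows "winding_number (linepath (Complex a y) (Complex b y)) w
       + winding_number (linepath (Complex b y) (Complex c y)) w
       + winding_number (linepath (Complex c y) (Complex a y)) w = 0"
proof -
  define H where "H = {z. Im z = y}"
  have conv: "convex H"
    unfolding H_def using convex_hyperplane[of \<i> y] by simp
  have seg: "closed_segment (Complex p y) (Complex q y) \<subseteq> H" for p q
    using conv by (intro closed_segment_subset) (auto simp: H_def)
  have w: "w \<notin> H" using assms by (simp add: H_def)
  define L where "L = linepath (Complex a y) (Complex b y) +++ linepath (Complex b y) (Complex c y)
      +++ linepath (Complex c y) (Complex a y)"
  have nin: "w \<notin> closed_segment (Complex p y) (Complex q y)" for p q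
    using seg w by blast
  have "winding_number L w = 0"
    by (rule winding_number_zero_outside[of L H])
      (use conv w seg in \<open>auto simp: L_def path_image_join\<close>)
  moreover have "winding_number L w = winding_number (linepath (Complex a y) (Complex b y)) w
       + (winding_number (linepath (Complex b y) (Complex c y)) w
       + winding_number (linepath (Complex c y) (Complex a y)) w)"
    unfolding L_def using nin by (simp add: winding_number_join path_image_join)
  ultimately show ?thesis by (simp add: add.assoc)
qed

lemma winding_number_linepath_reverse:
  "w \<notin> closed_segment a b \<Longrightarrow> winding_number (linepath b a) w = - winding_number (linepath a b) w"
  using winding_number_reversepath[of "linepath a b" w] by simp

definition contour_loop where
  "contour_loop \<gamma>1 c1 \<gamma>2 c2 R = truncated c1 R +++ linepath (Complex \<gamma>1 R) (Complex \<gamma>2 R)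
     +++ reversepath (truncated c2 R) +++ linepath (Complex \<gamma>2 (-R)) (Complex \<gamma>1 (-R))"

text \<open>
  Both contours are closed up along the same far vertical line, on the side away from \<open>w\<close>; the
  loop between them is the difference of these two closed curves.
\<close>

lemma winding_number_contour_loop_same_side:
  assumes c1: "vertical_contour \<gamma>1 c1" and c2: "vertical_contour \<gamma>2 c2"
    and H: "convex H" "x \<notin> H" "range c1 \<subseteq> H" "range c2 \<subseteq> H"
    and X: "\<And>B. \<exists>X. B \<le> \<bar>X\<bar> \<and> (\<forall>y. Complex X y \<in> H)"
    and w1: "path_component (- range c1) w x" and w2: "path_component (- range c2) w x"
  shows "eventually (\<lambda>R. winding_number (contour_loop \<gamma>1 c1 \<gamma>2 c2 R) w = 0) at_top"
proof -
  obtain B1 where B1: "\<And>R X. B1 \<le> R \<Longrightarrow> B1 \<le> \<bar>X\<bar> \<Longrightarrow> (\<And>y. Complex X y \<in> H) \<Longrightarrow>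
     winding_number (truncated c1 R) w + winding_number (linepath (Complex \<gamma>1 R) (Complex X R)) w
     + winding_number (linepath (Complex X R) (Complex X (-R))) w
     + winding_number (linepath (Complex X (-R)) (Complex \<gamma>1 (-R))) w = 0"
    using closed_up_winding_number[OF c1 H(1-3) w1] by metis
  obtain B2 where B2: "\<And>R X. B2 \<le> R \<Longrightarrow> B2 \<le> \<bar>X\<bar> \<Longrightarrow> (\<And>y. Complex X y \<in> H) \<Longrightarrow>
     winding_number (truncated c2 R) w + winding_number (linepath (Complex \<gamma>2 R) (Complex X R)) w
     + winding_number (linepath (Complex X R) (Complex X (-R))) w
     + winding_number (linepath (Complex X (-R)) (Complex \<gamma>2 (-R))) w = 0"
    using closed_up_winding_number[OF c2 H(1,2,4) w2] by metis
  obtain T1 where T1: "T1 > 0" "\<And>t. \<bar>t\<bar> \<ge> T1 \<Longrightarrow> c1 t = Complex \<gamma>1 t"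
    using c1 by (auto simp: vertical_contour_def)
  obtain T2 where T2: "T2 > 0" "\<And>t. \<bar>t\<bar> \<ge> T2 \<Longrightarrow> c2 t = Complex \<gamma>2 t"
    using c2 by (auto simp: vertical_contour_def)
  obtain X where X: "max B1 B2 \<le> \<bar>X\<bar>" "\<And>y. Complex X y \<in> H" using X by blast
  define B where "B = max (max B1 B2) (max (max T1 T2) (\<bar>Im w\<bar> + 1))"
  have "winding_number (contour_loop \<gamma>1 c1 \<gamma>2 c2 R) w = 0" if "B \<le> R" for R
  proof -
    have R: "B1 \<le> R" "B2 \<le> R" "T1 \<le> R" "T2 \<le> R" "\<bar>Im w\<bar> < R" "R > 0"
      using that T1 by (auto simp: B_def)
    have ends: "c1 R = Complex \<gamma>1 R" "c1 (-R) = Complex \<gamma>1 (-R)" "c2 R = Complex \<gamma>2 R" "c2 (-R) = Complex \<gamma>2 (-R)"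
      using R T1 T2 by auto
    have pt: "path (truncated c1 R)" "path (truncated c2 R)"
      by (rule path_truncated[OF c1], rule path_truncated[OF c2])
    have nin: "w \<notin> path_image (truncated c1 R)" "w \<notin> path_image (truncated c2 R)"
      using w1 w2 R(6) path_component_mem(1) by (fastforce simp: path_image_truncated)+
    have seg: "w \<notin> closed_segment (Complex a R) (Complex b R)" "w \<notin> closed_segment (Complex a (-R)) (Complex b (-R))" for a b
      using R by (auto dest: Im_horizontal_segment)
    \<comment> \<open>Here \<open>v\<close> belongs to the far vertical segment, which both closed
      curves share and which cancels; \<open>t\<close> and \<open>u\<close> belong to the horizontal
      edges of the loop and absorb the differences of the \<open>a\<close>'s and of the
      \<open>b\<close>'s.\<close>
    have alg: "p1 + (t + (- p2 + u)) = 0" if "p1 + a1 + v + b1 = 0" "p2 + a2 + v + b2 = 0"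
      "t + a2 - a1 = 0" "u - b1 + b2 = 0" for p1 p2 t u v a1 a2 b1 b2 :: complex
      using that by algebra
    have loop: "winding_number (contour_loop \<gamma>1 c1 \<gamma>2 c2 R) w = winding_number (truncated c1 R) w
      + (winding_number (linepath (Complex \<gamma>1 R) (Complex \<gamma>2 R)) w + (- winding_number (truncated c2 R) w
      + winding_number (linepath (Complex \<gamma>2 (-R)) (Complex \<gamma>1 (-R))) w))"
      unfolding contour_loop_def using nin seg pt
      by (simp add: winding_number_join path_image_join ends winding_number_reversepath)
    have tri1: "winding_number (linepath (Complex \<gamma>1 R) (Complex \<gamma>2 R)) w
       + winding_number (linepath (Complex \<gamma>2 R) (Complex X R)) w
       - winding_number (linepath (Complex \<gamma>1 R) (Complex X R)) w = 0"
      using winding_number_collinear_triangle[of w R \<gamma>1 \<gamma>2 X] R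
        winding_number_linepath_reverse[OF seg(1), of \<gamma>1 X] by simp
    have tri2: "winding_number (linepath (Complex \<gamma>2 (-R)) (Complex \<gamma>1 (-R))) w
       - winding_number (linepath (Complex X (-R)) (Complex \<gamma>1 (-R))) w
       + winding_number (linepath (Complex X (-R)) (Complex \<gamma>2 (-R))) w = 0"
      using winding_number_collinear_triangle[of w "-R" \<gamma>2 \<gamma>1 X] R
        winding_number_linepath_reverse[OF seg(2), of X \<gamma>1] by auto
    have X12: "B1 \<le> \<bar>X\<bar>" "B2 \<le> \<bar>X\<bar>" using X(1) by auto
    show ?thesis
      unfolding loop by (rule alg[OF B1[OF R(1) X12(1) X(2)] B2[OF R(2) X12(2) X(2)] tri1 tri2])
  qed
  then show ?thesis unfolding eventually_at_top_linorder by blast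
qed

lemma side_path_component:
  assumes "vertical_contour \<gamma> c"
  shows "w \<in> left_side c \<Longrightarrow> eventually (\<lambda>x. path_component (- range c) w (complex_of_real x)) at_bot"
    and "w \<in> right_side c \<Longrightarrow> eventually (\<lambda>x. path_component (- range c) w (complex_of_real x)) at_top"
proof -
  have "open (- range c)" using vertical_contour_closed_range[OF assms] by auto
  then have eq: "path_component (- range c) = connected_component (- range c)"
    by (simp add: open_path_connected_component fun_eq_iff)
  show "w \<in> left_side c \<Longrightarrow> eventually (\<lambda>x. path_component (- range c) w (complex_of_real x)) at_bot"
    and "w \<in> right_side c \<Longrightarrow> eventually (\<lambda>x. path_component (- range c) w (complex_of_real x)) at_top"
    unfolding eq left_side_def right_side_def by blast+
qed

text \<open>A point on both left sides is joined to a real \<open>x\<close> left of both contours.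
  The half-plane \<open>Re z > x\<close> contains both contours and leaves room to close them up far
  to the right.\<close>

lemma winding_number_contour_loop_left:
  assumes c1: "vertical_contour \<gamma>1 c1" and c2: "vertical_contour \<gamma>2 c2"
    and w: "w \<in> left_side c1" "w \<in> left_side c2"
  shows "eventually (\<lambda>R. winding_number (contour_loop \<gamma>1 c1 \<gamma>2 c2 R) w = 0) at_top"
proof -
  obtain K1 where K1: "\<And>t. \<bar>Re (c1 t)\<bar> < K1" by (rule vertical_contour_bounded_Re[OF c1]) blast
  obtain K2 where K2: "\<And>t. \<bar>Re (c2 t)\<bar> < K2" by (rule vertical_contour_bounded_Re[OF c2]) blast
  have "eventually (\<lambda>x. path_component (- range c1) w (complex_of_real x) \<and>
      path_component (- range c2) w (complex_of_real x) \<and> x \<le> - max K1 K2) at_bot"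
    using side_path_component(1)[OF c1 w(1)] side_path_component(1)[OF c2 w(2)] eventually_le_at_bot
    by (intro eventually_conj)
  then obtain x where x: "path_component (- range c1) w (complex_of_real x)"
      "path_component (- range c2) w (complex_of_real x)" "x \<le> - max K1 K2"
    using eventually_happens'[OF trivial_limit_at_bot_linorder] by blast
  show ?thesis
  proof (rule winding_number_contour_loop_same_side[OF c1 c2 _ _ _ _ _ x(1,2)])
    show "convex {z. Re z > x}" by (rule convex_halfspace_Re_gt)
    show "range c1 \<subseteq> {z. Re z > x}" "range c2 \<subseteq> {z. Re z > x}"
    proof -
      have "x < Re (c1 t)" "x < Re (c2 t)" for t using K1[of t] K2[of t] x(3) by linarith+
      then show "range c1 \<subseteq> {z. Re z > x}" "range c2 \<subseteq> {z. Re z > x}" by auto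
    qed
    show "\<exists>X. B \<le> \<bar>X\<bar> \<and> (\<forall>y. Complex X y \<in> {z. Re z > x})" for B
      by (intro exI[of _ "max B (x + 1)"]) auto
    show "complex_of_real x \<notin> {z. Re z > x}" by simp
  qed
qed

lemma winding_number_contour_loop_right:
  assumes c1: "vertical_contour \<gamma>1 c1" and c2: "vertical_contour \<gamma>2 c2"
    and w: "w \<in> right_side c1" "w \<in> right_side c2"
  shows "eventually (\<lambda>R. winding_number (contour_loop \<gamma>1 c1 \<gamma>2 c2 R) w = 0) at_top"
proof -
  obtain K1 where K1: "\<And>t. \<bar>Re (c1 t)\<bar> < K1" by (rule vertical_contour_bounded_Re[OF c1]) blast
  obtain K2 where K2: "\<And>t. \<bar>Re (c2 t)\<bar> < K2" by (rule vertical_contour_bounded_Re[OF c2]) blast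
  have "eventually (\<lambda>x. path_component (- range c1) w (complex_of_real x) \<and>
      path_component (- range c2) w (complex_of_real x) \<and> max K1 K2 \<le> x) at_top"
    using side_path_component(2)[OF c1 w(1)] side_path_component(2)[OF c2 w(2)] eventually_ge_at_top
    by (intro eventually_conj)
  then obtain x where x: "path_component (- range c1) w (complex_of_real x)"
      "path_component (- range c2) w (complex_of_real x)" "max K1 K2 \<le> x"
    using eventually_happens'[OF trivial_limit_at_top_linorder] by blast
  show ?thesis
  proof (rule winding_number_contour_loop_same_side[OF c1 c2 _ _ _ _ _ x(1,2)])
    show "convex {z. Re z < x}" by (rule convex_halfspace_Re_lt)
    show "range c1 \<subseteq> {z. Re z < x}" "range c2 \<subseteq> {z. Re z < x}"
    proof -
      have "Re (c1 t) < x" "Re (c2 t) < x" for t using K1[of t] K2[of t] x(3) by linarith+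
      then show "range c1 \<subseteq> {z. Re z < x}" "range c2 \<subseteq> {z. Re z < x}" by auto
    qed
    show "\<exists>X. B \<le> \<bar>X\<bar> \<and> (\<forall>y. Complex X y \<in> {z. Re z < x})" for B
      by (intro exI[of _ "- max \<bar>B\<bar> (\<bar>x\<bar> + 1)"]) auto
    show "complex_of_real x \<notin> {z. Re z < x}" by simp
  qed
qed

section \<open>Independence of the contour\<close>

lemma exp_decay_integrable:
  fixes \<epsilon> :: real
  assumes "\<epsilon> > 0"
  shows "(\<lambda>t. exp (- \<epsilon> * \<bar>t\<bar>)) integrable_on UNIV"
proof -
  have 1: "(\<lambda>t. exp (- \<epsilon> * \<bar>t\<bar>)) integrable_on {0..}"
    using integrable_on_exp_minus_to_infinity[OF assms, of 0]
    by (rule integrable_eq) auto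
  then have "(\<lambda>t. exp (- \<epsilon> * \<bar>t\<bar>)) absolutely_integrable_on {0..}"
    by (intro nonnegative_absolutely_integrable_1) auto
  then have "(\<lambda>t. exp (- \<epsilon> * \<bar>- t\<bar>)) absolutely_integrable_on {..0}"
    using has_absolute_integral_reflect_real[of "{..0}" "{0..}" "\<lambda>t. exp (- \<epsilon> * \<bar>t\<bar>)"] by auto
  then have 2: "(\<lambda>t. exp (- \<epsilon> * \<bar>t\<bar>)) integrable_on {..0}"
    by (simp add: set_lebesgue_integral_eq_integral)
  have "(\<lambda>t. exp (- \<epsilon> * \<bar>t\<bar>)) integrable_on ({0..} \<union> {..0})"
    by (rule integrable_Un[OF _ 1 2]) (auto intro: negligible_subset[OF negligible_sing[of 0]])
  moreover have "{0..} \<union> {..0} = (UNIV :: real set)" by auto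
  ultimately show ?thesis by simp
qed

text \<open>The central part \<open>F1\<close> is only known to be gauge integrable: the derivative
  of a piecewise smooth curve may be unbounded near its exceptional points. Dominated convergence is
  therefore applied to the tail \<open>F2\<close> alone, and \<open>F1\<close> contributes the same
  value to every large interval.\<close>

lemma integral_UNIV_limit:
  fixes F :: "real \<Rightarrow> complex"
  assumes int: "\<And>R. R \<ge> T \<Longrightarrow> F integrable_on {-R..R}" and \<epsilon>: "\<epsilon> > 0"
    and bound: "\<And>t. \<bar>t\<bar> > T \<Longrightarrow> norm (F t) \<le> C * exp (- \<epsilon> * \<bar>t\<bar>)"
  shows "F integrable_on UNIV" "(\<lambda>n. integral {- (T + real n)..T + real n} F) \<longlonglongrightarrow> integral UNIV F"
proof -
  define F1 where "F1 t = (if t \<in> {-T..T} then F t else 0)" for t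
  define F2 where "F2 t = (if t \<in> {-T..T} then 0 else F t)" for t
  have F12: "F = (\<lambda>t. F1 t + F2 t)" by (auto simp: F1_def F2_def)
  have F1U: "F1 integrable_on UNIV"
    unfolding F1_def using int[of T] by (simp only: integrable_restrict_UNIV order_refl)
  then have F1: "F1 integrable_on {a..b}" for a b
    using integrable_on_subinterval by blast
  have F1_eq: "integral S F1 = integral UNIV F1" if "{-T..T} \<subseteq> S" for S
    using that unfolding F1_def integral_restrict_Int by (simp add: Int_absorb1 Int_absorb2)
  define G where "G n t = (if t \<in> {- (T + real n)..T + real n} then F2 t else 0)" for n t
  have sub: "{-T..T} \<subseteq> {- (T + real n)..T + real n}" for n by auto
  have F2n: "F2 integrable_on {- (T + real n)..T + real n}" for n
  proof -
    have "(\<lambda>t. F t - F1 t) integrable_on {- (T + real n)..T + real n}"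
      by (intro integrable_diff int F1) auto
    moreover have "(\<lambda>t. F t - F1 t) = F2" by (auto simp: F1_def F2_def)
    ultimately show ?thesis by simp
  qed
  have Gn: "G n integrable_on UNIV" for n
    unfolding G_def using F2n by (simp only: integrable_restrict_UNIV)
  have h: "(\<lambda>t. \<bar>C\<bar> * exp (- \<epsilon> * \<bar>t\<bar>)) integrable_on UNIV"
    using exp_decay_integrable[OF \<epsilon>] by (rule integrable_on_mult_right)
  have le: "norm (G n t) \<le> \<bar>C\<bar> * exp (- \<epsilon> * \<bar>t\<bar>)" for n t
  proof (cases "\<bar>t\<bar> > T")
    case True
    have "norm (G n t) \<le> norm (F t)" by (auto simp: G_def F2_def)
    also have "\<dots> \<le> C * exp (- \<epsilon> * \<bar>t\<bar>)" by (rule bound[OF True])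
    also have "\<dots> \<le> \<bar>C\<bar> * exp (- \<epsilon> * \<bar>t\<bar>)" by (intro mult_right_mono) auto
    finally show ?thesis .
  qed (auto simp: G_def F2_def)
  have conv: "(\<lambda>n. G n t) \<longlonglongrightarrow> F2 t" for t
  proof (rule tendsto_eventually)
    obtain N where N: "\<bar>t\<bar> + \<bar>T\<bar> \<le> real N" using real_arch_simple by blast
    show "\<forall>\<^sub>F n in sequentially. G n t = F2 t"
      using eventually_ge_at_top[of N]
    proof eventually_elim
      case (elim n)
      then have "real N \<le> real n" by simp
      then show ?case using N by (auto simp: G_def)
    qed
  qed
  have dc: "F2 integrable_on UNIV" "(\<lambda>n. integral UNIV (G n)) \<longlonglongrightarrow> integral UNIV F2"
    using dominated_convergence[of G UNIV, OF Gn h le conv] by auto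
  show "F integrable_on UNIV" unfolding F12 by (rule integrable_add[OF F1U dc(1)])
  have "integral {- (T + real n)..T + real n} F = integral UNIV F1 + integral UNIV (G n)" for n
  proof -
    have "integral {- (T + real n)..T + real n} F
      = integral {- (T + real n)..T + real n} F1 + integral {- (T + real n)..T + real n} F2"
      unfolding F12 by (intro Henstock_Kurzweil_Integration.integral_add F1 F2n)
    then show ?thesis unfolding F1_eq[OF sub] G_def integral_restrict_UNIV .
  qed
  moreover have "integral UNIV F = integral UNIV F1 + integral UNIV F2"
    unfolding F12 by (rule Henstock_Kurzweil_Integration.integral_add[OF F1U dc(1)])
  ultimately show "(\<lambda>n. integral {- (T + real n)..T + real n} F) \<longlonglongrightarrow> integral UNIV F"
    using dc(2) by (simp add: tendsto_add)
qed

section \<open>Cauchy's theorem between two contours\<close>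

definition strip_decay :: "(complex \<Rightarrow> complex) \<Rightarrow> bool" where
  "strip_decay f \<longleftrightarrow> (\<exists>\<epsilon>>0. \<forall>a b. \<exists>C T. \<forall>s. a \<le> Re s \<and> Re s \<le> b \<and> T \<le> \<bar>Im s\<bar> \<longrightarrow>
     norm (f s) \<le> C * exp (- \<epsilon> * \<bar>Im s\<bar>))"

text \<open>A point on the curve is connected to nothing in the complement, so it is on neither
  side. An admissible contour thus misses every pole.\<close>

lemma side_disjoint_range: "left_side c \<inter> range c = {}" "right_side c \<inter> range c = {}"
proof -
  have "w \<notin> range c" if "w \<in> left_side c" for w
    using that eventually_happens'[OF trivial_limit_at_bot_linorder] connected_component_in
    unfolding left_side_def by (metis (mono_tags, lifting) ComplD mem_Collect_eq)
  moreover have "w \<notin> range c" if "w \<in> right_side c" for w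
    using that eventually_happens'[OF trivial_limit_at_top_linorder] connected_component_in
    unfolding right_side_def by (metis (mono_tags, lifting) ComplD mem_Collect_eq)
  ultimately show "left_side c \<inter> range c = {}" "right_side c \<inter> range c = {}" by auto
qed

lemma Re_closed_segment_bounds:
  assumes "s \<in> closed_segment x y"
  shows "min (Re x) (Re y) \<le> Re s" "Re s \<le> max (Re x) (Re y)"
proof -
  have "closed_segment x y \<subseteq> {s. min (Re x) (Re y) \<le> Re s} \<inter> {s. Re s \<le> max (Re x) (Re y)}"
    by (intro closed_segment_subset convex_Int convex_halfspace_Re_ge convex_halfspace_Re_le) auto
  with assms show "min (Re x) (Re y) \<le> Re s" "Re s \<le> max (Re x) (Re y)" by auto
qed

text \<open>Replaces the improper integral by integrals over finite paths, to which Cauchy's theorem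
  applies. All large starting heights \<open>T\<close> are allowed, so that two contours can be cut
  at the same heights.\<close>

lemma vertical_contour_integral_limit:
  assumes c: "vertical_contour \<gamma> c" and P: "closed P" "range c \<inter> P = {}"
    and f: "f holomorphic_on - P" "strip_decay f"
  obtains T0 where "\<And>T. T \<ge> T0 \<Longrightarrow> (\<lambda>n. contour_integral (truncated c (T + real n)) f)
      \<longlonglongrightarrow> integral UNIV (\<lambda>t. f (c t) * vector_derivative c (at t))"
    "\<And>R. R \<ge> T0 \<Longrightarrow> R > 0 \<and> valid_path (truncated c R) \<and> c R = Complex \<gamma> R \<and> c (-R) = Complex \<gamma> (-R)"
proof -
  define F where "F t = f (c t) * vector_derivative c (at t)" for t
  obtain T where T: "T > 0" "\<And>t. \<bar>t\<bar> \<ge> T \<Longrightarrow> c t = Complex \<gamma> t"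
    "\<And>R. R \<ge> T \<Longrightarrow> c piecewise_C1_differentiable_on {-R..R}"
    using vertical_contour_piecewise[OF c] by metis
  obtain \<epsilon> where \<epsilon>: "\<epsilon> > 0" "\<And>a b. \<exists>C T. \<forall>s. a \<le> Re s \<and> Re s \<le> b \<and> T \<le> \<bar>Im s\<bar> \<longrightarrow>
     norm (f s) \<le> C * exp (- \<epsilon> * \<bar>Im s\<bar>)"
    using f(2) unfolding strip_decay_def by blast
  obtain C T1 where T1: "\<And>s. Re s = \<gamma> \<Longrightarrow> T1 \<le> \<bar>Im s\<bar> \<Longrightarrow> norm (f s) \<le> C * exp (- \<epsilon> * \<bar>Im s\<bar>)"
    using \<epsilon>(2)[of \<gamma> \<gamma>] by auto
  have valid: "valid_path (truncated c R)" if "R \<ge> T" for R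
    using that T by (intro valid_path_truncated) auto
  have has: "(F has_integral contour_integral (truncated c R) f) {-R..R}" if R: "R \<ge> T" for R
  proof -
    have "R > 0" using R T(1) by simp
    have "path_image (truncated c R) \<subseteq> - P"
      using P(2) by (auto simp: path_image_truncated[OF \<open>R > 0\<close>])
    then have "f contour_integrable_on truncated c R"
      using f(1) P(1) valid[OF R] by (intro contour_integrable_holomorphic_simple[of f "- P"]) auto
    then show ?thesis
      unfolding F_def using has_contour_integral_truncated[OF \<open>R > 0\<close> T(3)[OF R]]
      by (simp add: has_contour_integral_integral)
  qed
  have bound: "norm (F t) \<le> C * exp (- \<epsilon> * \<bar>t\<bar>)" if "\<bar>t\<bar> > max T T1" for t
  proof -
    have "vector_derivative c (at t) = \<i>"
      using vertical_contour_tail_derivative[of T c \<gamma> t] T(2) that by (intro vector_derivative_at) auto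
    then have "norm (F t) = norm (f (Complex \<gamma> t))" using T(2)[of t] that by (simp add: F_def norm_mult)
    also have "\<dots> \<le> C * exp (- \<epsilon> * \<bar>t\<bar>)" using T1[of "Complex \<gamma> t"] that by simp
    finally show ?thesis .
  qed
  have lim: "F integrable_on UNIV" "(\<lambda>n. integral {- (T2 + real n)..T2 + real n} F) \<longlonglongrightarrow> integral UNIV F"
    if T2: "T2 \<ge> max T T1" for T2
  proof -
    have 1: "F integrable_on {-R..R}" if "R \<ge> T2" for R
      using has[of R] T2 that by (auto intro: has_integral_integrable)
    have 2: "norm (F t) \<le> C * exp (- \<epsilon> * \<bar>t\<bar>)" if "\<bar>t\<bar> > T2" for t
      using bound[of t] T2 that by auto
    show "F integrable_on UNIV" "(\<lambda>n. integral {- (T2 + real n)..T2 + real n} F) \<longlonglongrightarrow> integral UNIV F"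
      using integral_UNIV_limit[of T2 F \<epsilon> C, OF 1 \<epsilon>(1) 2] by auto
  qed
  have lim2: "(\<lambda>n. contour_integral (truncated c (T2 + real n)) f) \<longlonglongrightarrow> integral UNIV F"
    if T2: "T2 \<ge> max T T1" for T2
  proof -
    have "contour_integral (truncated c (T2 + real n)) f = integral {- (T2 + real n)..T2 + real n} F" for n
      using T2 by (intro integral_unique[OF has, symmetric]) auto
    then show ?thesis using lim(2)[OF T2] by simp
  qed
  show ?thesis
    by (rule that[of "max T T1"]) (use lim2 valid T in \<open>auto simp flip: F_def\<close>)
qed

text \<open>The loop between the contours has index zero about each pole, since each pole is on the
  same side of both. The truncated integrals hence differ only by the two horizontal edges, which
  have bounded length and vanish exponentially as the height grows.\<close>

lemma vertical_contours_integral_eq: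
  assumes c1: "vertical_contour \<gamma>1 c1" and c2: "vertical_contour \<gamma>2 c2"
    and P: "closed P" "\<And>a b. finite {s \<in> P. a \<le> Re s \<and> Re s \<le> b}" "P = PL \<union> PR"
    and PL: "PL \<subseteq> left_side c1" "PL \<subseteq> left_side c2"
    and PR: "PR \<subseteq> right_side c1" "PR \<subseteq> right_side c2"
    and f: "f holomorphic_on - P" "strip_decay f"
  shows "integral UNIV (\<lambda>t. f (c1 t) * vector_derivative c1 (at t))
       = integral UNIV (\<lambda>t. f (c2 t) * vector_derivative c2 (at t))"
proof -
  have disj: "range c1 \<inter> P = {}" "range c2 \<inter> P = {}"
  proof -
    have "range c \<inter> P = {}" if "PL \<subseteq> left_side c" "PR \<subseteq> right_side c" for c
    proof -
      have "PL \<inter> range c = {}" "PR \<inter> range c = {}"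
        using Int_mono[OF that(1) order_refl, of "range c"] Int_mono[OF that(2) order_refl, of "range c"]
        by (simp_all add: side_disjoint_range)
      then show ?thesis unfolding P(3) Int_Un_distrib by (simp add: Int_commute)
    qed
    with PL PR show "range c1 \<inter> P = {}" "range c2 \<inter> P = {}" by auto
  qed
  obtain T1 where T1: 
    "\<And>T. T \<ge> T1 \<Longrightarrow> (\<lambda>n. contour_integral (truncated c1 (T + real n)) f)
      \<longlonglongrightarrow> integral UNIV (\<lambda>t. f (c1 t) * vector_derivative c1 (at t))"
    "\<And>R. R \<ge> T1 \<Longrightarrow> R > 0 \<and> valid_path (truncated c1 R) \<and> c1 R = Complex \<gamma>1 R \<and> c1 (-R) = Complex \<gamma>1 (-R)"
    by (rule vertical_contour_integral_limit[OF c1 P(1) disj(1) f]) (rule that)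
  obtain T2 where T2: 
    "\<And>T. T \<ge> T2 \<Longrightarrow> (\<lambda>n. contour_integral (truncated c2 (T + real n)) f)
      \<longlonglongrightarrow> integral UNIV (\<lambda>t. f (c2 t) * vector_derivative c2 (at t))"
    "\<And>R. R \<ge> T2 \<Longrightarrow> R > 0 \<and> valid_path (truncated c2 R) \<and> c2 R = Complex \<gamma>2 R \<and> c2 (-R) = Complex \<gamma>2 (-R)"
    by (rule vertical_contour_integral_limit[OF c2 P(1) disj(2) f]) (rule that)
  obtain \<epsilon> where \<epsilon>: "\<epsilon> > 0" "\<And>a b. \<exists>C T. \<forall>s. a \<le> Re s \<and> Re s \<le> b \<and> T \<le> \<bar>Im s\<bar> \<longrightarrow>
     norm (f s) \<le> C * exp (- \<epsilon> * \<bar>Im s\<bar>)"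
    using f(2) unfolding strip_decay_def by blast
  define a b where "a = min \<gamma>1 \<gamma>2" and "b = max \<gamma>1 \<gamma>2"
  obtain C T3 where T3: "\<And>s. a \<le> Re s \<Longrightarrow> Re s \<le> b \<Longrightarrow> T3 \<le> \<bar>Im s\<bar> \<Longrightarrow> norm (f s) \<le> C * exp (- \<epsilon> * \<bar>Im s\<bar>)"
    using \<epsilon>(2)[of a b] by auto
  obtain K1 where K1: "\<And>t. \<bar>Re (c1 t)\<bar> < K1" using vertical_contour_bounded_Re[OF c1] by metis
  obtain K2 where K2: "\<And>t. \<bar>Re (c2 t)\<bar> < K2" using vertical_contour_bounded_Re[OF c2] by metis
  define K where "K = max K1 K2"
  define strip where "strip = {s. - K < Re s} \<inter> {s. Re s < K}"
  \<comment> \<open>How tall the loop must be depends on the pole; finiteness of \<open>Q\<close>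
    yields one height for all of them. The other poles lie outside the strip that contains the
    loop.\<close>
  define Q where "Q = {s \<in> P. - K \<le> Re s \<and> Re s \<le> K}"
  have strip: "open strip" "convex strip"
    unfolding strip_def
    by (intro open_Int open_halfspace_Re_gt open_halfspace_Re_lt convex_Int convex_halfspace_Re_gt
        convex_halfspace_Re_lt)+
  have fin: "finite Q" using P(2) by (simp add: Q_def)
  have c_strip: "c1 t \<in> strip" "c2 t \<in> strip" for t
    using K1[of t] K2[of t] by (auto simp: strip_def K_def)
  have c_notin: "c1 t \<notin> P" "c2 t \<notin> P" for t
    using disj by (metis disjoint_iff rangeI)+
  have Qzero: "eventually (\<lambda>R. \<forall>w\<in>Q. winding_number (contour_loop \<gamma>1 c1 \<gamma>2 c2 R) w = 0) at_top"
  proof (rule eventually_ball_finite[OF fin], rule ballI)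
    fix w assume "w \<in> Q"
    then consider "w \<in> PL" | "w \<in> PR" using P(3) by (auto simp: Q_def)
    then show "eventually (\<lambda>R. winding_number (contour_loop \<gamma>1 c1 \<gamma>2 c2 R) w = 0) at_top"
    proof cases
      case 1 then show ?thesis using PL by (intro winding_number_contour_loop_left[OF c1 c2]) auto
    next
      case 2 then show ?thesis using PR by (intro winding_number_contour_loop_right[OF c1 c2]) auto
    qed
  qed
  obtain R0 where R0: "\<And>R w. R \<ge> R0 \<Longrightarrow> w \<in> Q \<Longrightarrow> winding_number (contour_loop \<gamma>1 c1 \<gamma>2 c2 R) w = 0"
    using Qzero unfolding eventually_at_top_linorder by blast
  obtain M where M: "\<And>s. s \<in> Q \<Longrightarrow> norm s \<le> M"
    using finite_imp_bounded[OF fin] by (auto simp: bounded_iff)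
  define T where "T = max (max T1 T2) (max (max T3 R0) (\<bar>M\<bar> + 1))"
  have est: "norm (contour_integral (truncated c1 R) f - contour_integral (truncated c2 R) f)
      \<le> 2 * (\<bar>C\<bar> * exp (- \<epsilon> * R) * \<bar>\<gamma>2 - \<gamma>1\<bar>)" if "R \<ge> T" for R
  proof -
    have R: "R \<ge> T1" "R \<ge> T2" "R \<ge> T3" "R \<ge> R0" "R > M" using that by (auto simp: T_def)
    note R1 = T1(2)[OF R(1)] and R2 = T2(2)[OF R(2)]
    then have "R > 0" by simp
    define l1 where "l1 = linepath (Complex \<gamma>1 R) (Complex \<gamma>2 R)"
    define l2 where "l2 = linepath (Complex \<gamma>2 (-R)) (Complex \<gamma>1 (-R))"
    have ends: "Complex \<gamma>1 R \<in> strip" "Complex \<gamma>2 R \<in> strip" "Complex \<gamma>1 (-R) \<in> strip" "Complex \<gamma>2 (-R) \<in> strip"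
      using R1 R2 c_strip by metis+
    have lstrip: "path_image l1 \<subseteq> strip" "path_image l2 \<subseteq> strip"
      unfolding l1_def l2_def path_image_linepath by (intro closed_segment_subset strip ends)+
    have lIm: "Im s = R" if "s \<in> path_image l1" for s
      using that unfolding l1_def path_image_linepath by (rule Im_horizontal_segment)
    have lIm2: "Im s = - R" if "s \<in> path_image l2" for s
      using that unfolding l2_def path_image_linepath by (rule Im_horizontal_segment)
    have stripP: "s \<notin> P" if "s \<in> strip" "\<bar>Im s\<bar> = R" for s
    proof
      assume "s \<in> P"
      then have "s \<in> Q" using that(1) by (auto simp: Q_def strip_def)
      from M[OF this] show False using abs_Im_le_cmod[of s] that(2) R(5) by linarith
    qed
    have lP: "path_image l1 \<subseteq> strip - P" "path_image l2 \<subseteq> strip - P"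
    proof -
      have "s \<in> strip - P" if "s \<in> path_image l1" for s
        using subsetD[OF lstrip(1) that] stripP[of s] lIm[OF that] \<open>R > 0\<close> by simp
      moreover have "s \<in> strip - P" if "s \<in> path_image l2" for s
        using subsetD[OF lstrip(2) that] stripP[of s] lIm2[OF that] \<open>R > 0\<close> by simp
      ultimately show "path_image l1 \<subseteq> strip - P" "path_image l2 \<subseteq> strip - P" by blast+
    qed
    define L where "L = contour_loop \<gamma>1 c1 \<gamma>2 c2 R"
    have L_eq: "L = truncated c1 R +++ l1 +++ reversepath (truncated c2 R) +++ l2"
      by (simp add: L_def contour_loop_def l1_def l2_def)
    have valid: "valid_path L" "pathfinish L = pathstart L"
      using R1 R2 by (auto simp: L_eq l1_def l2_def intro!: valid_path_join)
    have cP: "path_image (truncated c1 R) \<subseteq> strip - P" "path_image (truncated c2 R) \<subseteq> strip - P"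
      using c_strip c_notin \<open>R > 0\<close> by (simp_all add: path_image_truncated image_subset_iff)
    have img: "path_image L \<subseteq> strip - P"
      using cP lP R1 R2 by (auto simp: L_eq path_image_join l1_def l2_def)
    have op: "open (strip - P)" using strip(1) P(1) by (rule open_Diff)
    have hol: "f holomorphic_on strip - P" using f(1) by (rule holomorphic_on_subset) auto
    \<comment> \<open>Such a point is either a pole in \<open>Q\<close>, covered by the choice of
      \<open>R0\<close>, or lies outside the convex set \<open>strip\<close>.\<close>
    have wn: "winding_number L w = 0" if "w \<notin> strip - P" for w
    proof (cases "w \<in> strip")
      case True
      then have "w \<in> Q" using that by (auto simp: Q_def strip_def)
      then show ?thesis using R0[OF R(4)] by (simp add: L_def)
    next
      case False
      show ?thesis
        by (rule winding_number_zero_outside[of L strip])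
          (use valid img strip False in \<open>auto simp: valid_path_imp_path\<close>)
    qed
    have zero: "contour_integral L f = 0"
      using Cauchy_theorem_global[OF op hol valid img wn] by (rule contour_integral_unique)
    have intb: "f contour_integrable_on truncated c1 R" "f contour_integrable_on truncated c2 R"
        "f contour_integrable_on l1" "f contour_integrable_on l2"
      using R1 R2 cP lP by (auto intro!: contour_integrable_holomorphic_simple[OF hol op] simp: l1_def l2_def)
    have "contour_integral L f = contour_integral (truncated c1 R) f + (contour_integral l1 f
        + (- contour_integral (truncated c2 R) f + contour_integral l2 f))"
      unfolding L_eq using intb R1 R2
      by (simp add: contour_integral_reversepath contour_integrable_reversepath l1_def l2_def)
    then have "contour_integral (truncated c1 R) f - contour_integral (truncated c2 R) f
        = - (contour_integral l1 f + contour_integral l2 f)"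
      using zero by (simp add: add_eq_0_iff algebra_simps)
    then have "norm (contour_integral (truncated c1 R) f - contour_integral (truncated c2 R) f)
        \<le> norm (contour_integral l1 f) + norm (contour_integral l2 f)"
      by (simp add: norm_triangle_ineq del: minus_add_distrib)
    also have "norm (contour_integral l1 f) \<le> \<bar>C\<bar> * exp (- \<epsilon> * R) * norm (Complex \<gamma>2 R - Complex \<gamma>1 R)"
      unfolding l1_def
    proof (rule contour_integral_bound_linepath)
      fix s assume s: "s \<in> closed_segment (Complex \<gamma>1 R) (Complex \<gamma>2 R)"
      have "Im s = R" "a \<le> Re s" "Re s \<le> b"
        using s lIm Re_closed_segment_bounds[OF s] by (auto simp: l1_def a_def b_def)
      then have "norm (f s) \<le> C * exp (- \<epsilon> * R)" using T3[of s] R(3) \<open>R > 0\<close> by simp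
      also have "\<dots> \<le> \<bar>C\<bar> * exp (- \<epsilon> * R)" by (intro mult_right_mono) auto
      finally show "norm (f s) \<le> \<bar>C\<bar> * exp (- \<epsilon> * R)" .
    qed (use intb in \<open>auto simp: l1_def\<close>)
    also have "norm (contour_integral l2 f) \<le> \<bar>C\<bar> * exp (- \<epsilon> * R) * norm (Complex \<gamma>1 (-R) - Complex \<gamma>2 (-R))"
      unfolding l2_def
    proof (rule contour_integral_bound_linepath)
      fix s assume s: "s \<in> closed_segment (Complex \<gamma>2 (-R)) (Complex \<gamma>1 (-R))"
      have "Im s = -R" "a \<le> Re s" "Re s \<le> b"
        using s lIm2 Re_closed_segment_bounds[OF s] by (auto simp: l2_def a_def b_def)
      then have "norm (f s) \<le> C * exp (- \<epsilon> * R)" using T3[of s] R(3) \<open>R > 0\<close> by simp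
      also have "\<dots> \<le> \<bar>C\<bar> * exp (- \<epsilon> * R)" by (intro mult_right_mono) auto
      finally show "norm (f s) \<le> \<bar>C\<bar> * exp (- \<epsilon> * R)" .
    qed (use intb in \<open>auto simp: l2_def\<close>)
    also have "Complex \<gamma>2 R - Complex \<gamma>1 R = of_real (\<gamma>2 - \<gamma>1)" by (simp add: complex_eq_iff)
    also have "Complex \<gamma>1 (-R) - Complex \<gamma>2 (-R) = of_real (\<gamma>1 - \<gamma>2)" by (simp add: complex_eq_iff)
    finally show ?thesis by (simp add: norm_of_real abs_minus_commute mult_ac del: of_real_diff)
  qed
  have "(\<lambda>n. contour_integral (truncated c1 (T + real n)) f - contour_integral (truncated c2 (T + real n)) f)
      \<longlonglongrightarrow> 0"
  proof (rule Lim_null_comparison)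
    show "\<forall>\<^sub>F n in sequentially. norm (contour_integral (truncated c1 (T + real n)) f
        - contour_integral (truncated c2 (T + real n)) f)
        \<le> 2 * (\<bar>C\<bar> * exp (- \<epsilon> * (T + real n)) * \<bar>\<gamma>2 - \<gamma>1\<bar>)"
      using est by simp
    have lim: "filterlim (\<lambda>n. T + real n) at_top sequentially"
      by (intro filterlim_tendsto_add_at_top[OF tendsto_const] filterlim_real_sequentially)
    have "filterlim (\<lambda>n. - \<epsilon> * (T + real n)) at_bot sequentially"
      using \<epsilon>(1) lim by (intro filterlim_tendsto_neg_mult_at_bot[OF tendsto_const]) auto
    then have "(\<lambda>n. exp (- \<epsilon> * (T + real n))) \<longlonglongrightarrow> 0"
      by (rule filterlim_compose[OF exp_at_bot])
    then show "(\<lambda>n. 2 * (\<bar>C\<bar> * exp (- \<epsilon> * (T + real n)) * \<bar>\<gamma>2 - \<gamma>1\<bar>)) \<longlonglongrightarrow> 0"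
      by (intro tendsto_mult_right_zero tendsto_mult_left_zero)
  qed
  moreover have "(\<lambda>n. contour_integral (truncated c1 (T + real n)) f - contour_integral (truncated c2 (T + real n)) f)
      \<longlonglongrightarrow> integral UNIV (\<lambda>t. f (c1 t) * vector_derivative c1 (at t))
       - integral UNIV (\<lambda>t. f (c2 t) * vector_derivative c2 (at t))"
    by (intro tendsto_diff T1(1) T2(1)) (auto simp: T_def)
  ultimately show ?thesis using LIMSEQ_unique by fastforce
qed

section \<open>Existence of a contour near the poles on the left\<close>

lemma polynomial_interpolation:
  fixes v :: "'a::field \<Rightarrow> 'a"
  assumes "finite A"
  obtains q where "\<And>x. x \<in> A \<Longrightarrow> poly q x = v x"
proof -
  have "\<exists>q. \<forall>x\<in>A. poly q x = v x"
    using assms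
  proof induction
    case empty then show ?case by auto
  next
    case (insert a A)
    then obtain q where q: "\<And>x. x \<in> A \<Longrightarrow> poly q x = v x" by auto
    \<comment> \<open>Newton's scheme: a multiple of the polynomial vanishing at the old nodes
      corrects the value at the new one.\<close>
    define r where "r = (\<Prod>b\<in>A. [:- b, 1:])"
    have r: "poly r x = (\<Prod>b\<in>A. x - b)" for x by (simp add: r_def poly_prod)
    have "poly r a \<noteq> 0" using insert.hyps by (auto simp: r)
    moreover have "poly r x = 0" if "x \<in> A" for x using insert.hyps(1) that by (auto simp: r)
    ultimately have "\<forall>x\<in>insert a A. poly (q + smult ((v a - poly q a) / poly r a) r) x = v x"
      using q by auto
    then show ?case by blast
  qed
  then show ?thesis using that by blast
qed

text \<open>
  The contour is the image of the imaginary axis under the injective map \<open>\<Psi>\<close>. It dips to the left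
  of all points of \<open>PR\<close> at height \<open>pi / 2\<close>, and is then sheared vertically by a polynomial \<open>q\<close>
  which moves the dip onto those points of \<open>PR\<close> that lie left of \<open>\<gamma>\<close> and avoids \<open>PL\<close>. The images
  of the two half-planes lie on the two sides.
\<close>

lemma separating_contour_exists:
  fixes PL PR :: "complex set" and p W lo :: real
  assumes real: "PL \<subseteq> \<real>" "PR \<subseteq> \<real>" and disj: "PL \<inter> PR = {}"
    and fin: "\<And>a b. finite {s \<in> PL \<union> PR. a \<le> Re s \<and> Re s \<le> b}"
    and PL: "\<And>s. s \<in> PL \<Longrightarrow> Re s \<le> p" and PR: "\<And>s. s \<in> PR \<Longrightarrow> lo \<le> Re s" and "p < W"
  obtains \<gamma> c d K F where "vertical_contour \<gamma> c" "PL \<subseteq> left_side c" "PR \<subseteq> right_side c"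
    "\<And>t. Re (c t) < W" "finite F" "\<And>t. t \<notin> F \<Longrightarrow> (c has_vector_derivative d t) (at t)"
    "d \<in> borel_measurable borel" "\<And>t. norm (d t) \<le> K"
proof -
  \<comment> \<open>The contour will pass through the real point \<open>\<gamma>\<close> at
    parameter 0, so \<open>\<gamma>\<close> must not be a pole: \<open>p < \<gamma>\<close> excludes
    \<open>PL\<close>, and removing finitely many abscissae excludes \<open>PR\<close>.\<close>
  have "infinite ({p<..<W} - Re ` {s \<in> PL \<union> PR. p \<le> Re s \<and> Re s \<le> W})"
    using fin \<open>p < W\<close> by (intro Diff_infinite_finite) auto
  then obtain \<gamma> where "\<gamma> \<in> {p<..<W} - Re ` {s \<in> PL \<union> PR. p \<le> Re s \<and> Re s \<le> W}"
    using infinite_imp_nonempty by blast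
  then have \<gamma>: "p < \<gamma>" "\<gamma> < W" "\<And>s. s \<in> PR \<Longrightarrow> Re s \<noteq> \<gamma>" by force+
  define h where "h = \<bar>\<gamma> - lo\<bar> + 1"
  have h: "h > 0" "\<gamma> - h < lo" by (auto simp: h_def)
  define x where "x t = \<gamma> - h * (if 0 \<le> t \<and> t \<le> pi then sin t else 0)" for t
  have x_bounds: "\<gamma> - h \<le> x t" "x t \<le> \<gamma>" for t
    using h by (auto simp: x_def sin_ge_zero mult_left_le)
  define A where "A = Re ` {s \<in> PL \<union> PR. \<gamma> - h \<le> Re s \<and> Re s \<le> \<gamma>}"
  \<comment> \<open>The preimage of a real \<open>a\<close> under the shear has height
    \<open>- poly q a\<close>. The value \<open>- pi / 2\<close> places it at the bottom of the dip,
    the value 0 at a height without a dip. The node \<open>\<gamma>\<close> leaves the vertical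
    tails in place. Real points outside the interval from \<open>\<gamma> - h\<close> to
    \<open>\<gamma>\<close> are on the correct side for every \<open>q\<close>.\<close>
  obtain q where q: "\<And>a. a \<in> insert \<gamma> A \<Longrightarrow> poly q a = (if of_real a \<in> PR \<and> a \<noteq> \<gamma> then - pi / 2 else 0)"
    using polynomial_interpolation[of "insert \<gamma> A" "\<lambda>a. if complex_of_real a \<in> PR \<and> a \<noteq> \<gamma> then - pi / 2 else 0"] fin
    by (auto simp: A_def)
  have q\<gamma>: "poly q \<gamma> = 0" using q[of \<gamma>] by simp
  have x_cont: "continuous_on UNIV x"
  proof -
    have "continuous_on ({..0} \<union> {0..}) (\<lambda>t. if t \<le> 0 then \<gamma> else if t \<le> pi then \<gamma> - h * sin t else \<gamma>)"
    proof (rule continuous_on_cases)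
      have "continuous_on ({0..pi} \<union> {pi..}) (\<lambda>t. if t \<le> pi then \<gamma> - h * sin t else \<gamma>)"
        by (rule continuous_on_cases) (auto intro!: continuous_intros)
      moreover have "{0..pi} \<union> {pi..} = {0..}" using order_trans[OF pi_ge_zero] by auto
      ultimately show "continuous_on {0..} (\<lambda>t. if t \<le> pi then \<gamma> - h * sin t else \<gamma>)" by simp
    qed auto
    moreover have "x = (\<lambda>t. if t \<le> 0 then \<gamma> else if t \<le> pi then \<gamma> - h * sin t else \<gamma>)"
      by (auto simp: x_def fun_eq_iff)
    moreover have "{..0} \<union> {0..} = (UNIV :: real set)" by auto
    ultimately show ?thesis by simp
  qed
  define \<Psi> where "\<Psi> z = Complex (Re z + x (Im z)) (Im z + poly q (Re z + x (Im z)))" for z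
  define c where "c t = \<Psi> (Complex 0 t)" for t
  have inj: "inj \<Psi>"
    by (rule injI) (auto simp: \<Psi>_def complex_eq_iff)
  have \<Psi>_cont: "continuous_on UNIV \<Psi>"
    unfolding \<Psi>_def Complex_eq
    by (intro continuous_intros continuous_on_compose2[OF x_cont]) auto
  \<comment> \<open>So the side of a real \<open>a\<close> is decided by comparing \<open>a\<close>
    with \<open>x (- poly q a)\<close>.\<close>
  have \<Psi>_inv: "of_real a = \<Psi> (Complex (a - x (- poly q a)) (- poly q a))" for a
    by (simp add: \<Psi>_def complex_eq_iff)
  have range_disj: "\<Psi> z \<notin> range c" if "Re z < 0 \<or> Re z > 0" for z
    using that by (auto simp: c_def dest!: injD[OF inj])
  have left: "of_real a \<in> left_side c" if "a < x (- poly q a)" for a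
  proof -
    have conn: "connected (\<Psi> ` {z. Re z < 0})"
      by (intro connected_continuous_image convex_connected convex_halfspace_Re_lt
          continuous_on_subset[OF \<Psi>_cont]) auto
    have "connected_component (- range c) (of_real a) (complex_of_real r)" if r: "r < \<gamma> - h" for r
      unfolding connected_component_def
    proof (intro exI conjI)
      show "connected (\<Psi> ` {z. Re z < 0})" by (rule conn)
      show "\<Psi> ` {z. Re z < 0} \<subseteq> - range c" using range_disj by (intro image_subsetI) simp
      show "of_real a \<in> \<Psi> ` {z. Re z < 0}"
        using \<Psi>_inv[of a] \<open>a < x (- poly q a)\<close> by force
      show "of_real r \<in> \<Psi> ` {z. Re z < 0}"
        using \<Psi>_inv[of r] r x_bounds(1)[of "- poly q r"] by force
    qed
    then show ?thesis
      unfolding left_side_def eventually_at_bot_dense by blast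
  qed
  have right: "of_real a \<in> right_side c" if "a > x (- poly q a)" for a
  proof -
    have conn: "connected (\<Psi> ` {z. Re z > 0})"
      by (intro connected_continuous_image convex_connected convex_halfspace_Re_gt
          continuous_on_subset[OF \<Psi>_cont]) auto
    have "connected_component (- range c) (of_real a) (complex_of_real r)" if r: "r > \<gamma>" for r
      unfolding connected_component_def
    proof (intro exI conjI)
      show "connected (\<Psi> ` {z. Re z > 0})" by (rule conn)
      show "\<Psi> ` {z. Re z > 0} \<subseteq> - range c" using range_disj by (intro image_subsetI) simp
      show "of_real a \<in> \<Psi> ` {z. Re z > 0}"
        using \<Psi>_inv[of a] \<open>a > x (- poly q a)\<close> by force
      show "of_real r \<in> \<Psi> ` {z. Re z > 0}"
        using \<Psi>_inv[of r] r x_bounds(2)[of "- poly q r"] by force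
    qed
    then show ?thesis
      unfolding right_side_def eventually_at_top_dense by blast
  qed
  have "PL \<subseteq> left_side c"
  proof
    fix s assume s: "s \<in> PL"
    define a where "a = Re s"
    have sa: "s = of_real a" using s real(1) by (auto simp: a_def Reals_def)
    have "a \<le> p" using PL[OF s] by (simp add: a_def)
    have "a < x (- poly q a)"
    proof (cases "a < \<gamma> - h")
      case True then show ?thesis using x_bounds(1) by (rule less_le_trans)
    next
      case False
      then have "a \<in> A" using s \<gamma>(1) \<open>a \<le> p\<close> by (auto simp: A_def a_def)
      then have "poly q a = 0" using q[of a] disj s sa by auto
      then show ?thesis using \<open>a \<le> p\<close> \<gamma>(1) by (simp add: x_def)
    qed
    then show "s \<in> left_side c" unfolding sa by (rule left)
  qed
  moreover have "PR \<subseteq> right_side c"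
  proof
    fix s assume s: "s \<in> PR"
    define a where "a = Re s"
    have sa: "s = of_real a" using s real(2) by (auto simp: a_def Reals_def)
    have "lo \<le> a" "a \<noteq> \<gamma>" using PR[OF s] \<gamma>(3)[OF s] by (simp_all add: a_def)
    have "x (- poly q a) < a"
    proof (cases "a > \<gamma>")
      case True then show ?thesis using x_bounds(2) by (rule le_less_trans[rotated])
    next
      case False
      then have "a \<in> A" using s \<open>lo \<le> a\<close> h(2) by (auto simp: A_def a_def)
      then have "poly q a = - pi / 2" using q[of a] s sa \<open>a \<noteq> \<gamma>\<close> by auto
      then have "x (- poly q a) = \<gamma> - h" by (simp add: x_def)
      then show ?thesis using \<open>lo \<le> a\<close> h(2) by simp
    qed
    then show "s \<in> right_side c" unfolding sa by (rule right)
  qed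
  moreover have "Re (c t) < W" for t
    using x_bounds(2)[of t] \<gamma>(2) by (simp add: c_def \<Psi>_def)
  moreover
  define f where "f t = Complex (\<gamma> - h * sin t) (t + poly q (\<gamma> - h * sin t))" for t
  define D where "D t = Complex (- h * cos t) (1 + poly (pderiv q) (\<gamma> - h * sin t) * (- h * cos t))" for t
  \<comment> \<open>The curve may have corners at 0 and \<open>pi\<close>, where the value of
    \<open>d\<close> is immaterial. An explicit bounded Borel derivative is exported because
    Fubini's theorem needs absolute integrability along the contour.\<close>
  define d where "d t = (if 0 < t \<and> t < pi then D t else \<i>)" for t
  have c_in: "c t = f t" if "0 \<le> t" "t \<le> pi" for t
    using that by (simp add: c_def \<Psi>_def f_def x_def)
  have c_out: "c t = Complex \<gamma> t" if "t \<le> 0 \<or> pi \<le> t" for t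
  proof -
    have "x t = \<gamma>" using that by (auto simp: x_def)
    then show ?thesis by (simp add: c_def \<Psi>_def q\<gamma>)
  qed
  have f_der: "(f has_vector_derivative D t) (at t)" for t
  proof -
    have 1: "((\<lambda>t. \<gamma> - h * sin t) has_real_derivative - h * cos t) (at t)"
      by (auto intro!: derivative_eq_intros)
    have 2: "((\<lambda>t. t + poly q (\<gamma> - h * sin t)) has_real_derivative
        1 + poly (pderiv q) (\<gamma> - h * sin t) * (- h * cos t)) (at t)"
      by (intro DERIV_add DERIV_ident DERIV_chain2[OF poly_DERIV 1])
    have "((\<lambda>t. of_real (\<gamma> - h * sin t) + \<i> * of_real (t + poly q (\<gamma> - h * sin t))) has_vector_derivative
        of_real (- h * cos t) + \<i> * of_real (1 + poly (pderiv q) (\<gamma> - h * sin t) * (- h * cos t))) (at t)"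
      using 1 2 by (intro has_vector_derivative_add has_vector_derivative_mult_right
          has_vector_derivative_of_real) (simp_all add: has_real_derivative_iff_has_vector_derivative)
    then show ?thesis unfolding f_def D_def Complex_eq .
  qed
  have D_cont: "continuous_on S D" for S
    unfolding D_def Complex_eq by (intro continuous_intros)
  have c_der: "(c has_vector_derivative d t) (at t)" if "t \<notin> {0, pi}" for t
  proof (cases "0 < t \<and> t < pi")
    case True
    have "(c has_vector_derivative D t) (at t)"
      by (rule has_vector_derivative_transform_within_open[OF f_der, of "{0<..<pi}"])
        (use True c_in in auto)
    then show ?thesis using True by (simp add: d_def)
  next
    case False
    have line: "((\<lambda>t. Complex \<gamma> t) has_vector_derivative \<i>) (at t)"
      unfolding Complex_eq by (auto intro!: derivative_eq_intros)
    have "(c has_vector_derivative \<i>) (at t)"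
      by (rule has_vector_derivative_transform_within_open[OF line, of "{..<0} \<union> {pi<..}"])
        (use False that c_out in auto)
    then show ?thesis by (simp only: d_def if_not_P[OF False])
  qed
  have c_cont: "continuous_on S c" for S
    unfolding c_def Complex_eq by (intro continuous_intros continuous_on_compose2[OF \<Psi>_cont]) auto
  have "vertical_contour \<gamma> c"
    unfolding vertical_contour_def
  proof (intro conjI exI)
    show "inj c" using inj by (auto simp: c_def inj_def)
    show "0 < pi" by simp
    show "\<forall>t. pi \<le> \<bar>t\<bar> \<longrightarrow> c t = Complex \<gamma> t"
      using pi_gt_zero by (auto intro!: c_out simp del: pi_gt_zero)
    have "continuous_on ({0<..<pi} \<union> ({..<0} \<union> {pi<..})) d"
    proof (rule continuous_on_open_Un)
      show "continuous_on {0<..<pi} d" by (rule continuous_on_eq[OF D_cont]) (auto simp: d_def)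
      show "continuous_on ({..<0} \<union> {pi<..}) d"
        by (rule continuous_on_eq[of _ "\<lambda>_. \<i>"]) (auto simp: d_def)
    qed auto
    then have "continuous_on ({- pi..pi} - {0, pi}) d"
      by (rule continuous_on_subset) auto
    then have "c C1_differentiable_on {- pi..pi} - {0, pi}"
      unfolding C1_differentiable_on_def using c_der by (intro exI[of _ d]) simp
    then show "c piecewise_C1_differentiable_on {- pi..pi}"
      unfolding piecewise_C1_differentiable_on_def using c_cont
      by (intro conjI exI[of _ "{0, pi}"]) simp_all
  qed
  moreover have "d \<in> borel_measurable borel"
  proof -
    have "D \<in> borel_measurable borel" using D_cont by (rule borel_measurable_continuous_onI)
    then show ?thesis unfolding d_def by measurable
  qed
  moreover obtain K where "\<And>t. norm (d t) \<le> K"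
  proof -
    have "compact (D ` {0..pi})" by (intro compact_continuous_image D_cont) auto
    then obtain B where B: "\<And>t. t \<in> {0..pi} \<Longrightarrow> norm (D t) \<le> B"
      by (meson bounded_iff compact_imp_bounded image_eqI)
    have "norm (d t) \<le> max B 1" for t
      using B[of t] by (auto simp: d_def)
    then show ?thesis using that by blast
  qed
  ultimately show ?thesis using c_der by (intro that[of \<gamma> c "{0, pi}" d K]) auto
qed

section \<open>Poles and growth of the integrand\<close>

text \<open>The sign of \<open>B\<close> is left open: a negative \<open>B\<close> gives the poles
  extending to the right, so one notion serves both rows.\<close>

definition pole_set :: "complex \<Rightarrow> real \<Rightarrow> complex set" where
  "pole_set \<beta> B = {s. \<beta> + of_real B * s \<in> \<int>\<^sub>\<le>\<^sub>0}"

definition left_poles :: "nat \<Rightarrow> fox_params \<Rightarrow> complex set" where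
  "left_poles m bs = (\<Union>(\<beta>, B) \<in> set (take m bs). pole_set \<beta> B)"

definition right_poles :: "nat \<Rightarrow> fox_params \<Rightarrow> complex set" where
  "right_poles n as = (\<Union>(\<alpha>, A) \<in> set (take n as). pole_set (1 - \<alpha>) (- A))"

lemma fox_contour_iff:
  "fox_contour m n as bs c \<longleftrightarrow> (\<exists>\<gamma>. vertical_contour \<gamma> c) \<and> left_poles m bs \<subseteq> left_side c \<and>
     right_poles n as \<subseteq> right_side c"
  unfolding fox_contour_def left_poles_def right_poles_def pole_set_def by (auto simp: UN_subset_iff)

lemma pole_setE:
  assumes "s \<in> pole_set \<beta> B"
  obtains l :: nat where "\<beta> + of_real B * s = - of_nat l"
  using assms by (auto simp: pole_set_def elim: nonpos_Ints_cases')

lemma closed_pole_set: "closed (pole_set \<beta> B)"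
  unfolding pole_set_def
  using continuous_closed_vimage[OF closed_nonpos_Ints, of "\<lambda>s. \<beta> + of_real B * s"]
  by (simp add: vimage_def continuous_intros)

lemma finite_pole_set_strip:
  assumes "B \<noteq> 0"
  shows "finite {s \<in> pole_set \<beta> B. a \<le> Re s \<and> Re s \<le> b}"
proof -
  define K where "K = \<bar>Re \<beta>\<bar> + \<bar>B\<bar> * (\<bar>a\<bar> + \<bar>b\<bar>)"
  have "{s \<in> pole_set \<beta> B. a \<le> Re s \<and> Re s \<le> b} \<subseteq> (\<lambda>l. (- of_nat l - \<beta>) / of_real B) ` {..nat \<lceil>K\<rceil>}"
  proof
    fix s assume s: "s \<in> {s \<in> pole_set \<beta> B. a \<le> Re s \<and> Re s \<le> b}"
    then obtain l :: nat where l: "\<beta> + of_real B * s = - of_nat l" by (auto elim: pole_setE)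
    have "real l = \<bar>Re (\<beta> + of_real B * s)\<bar>" unfolding l by simp
    also have "\<dots> \<le> \<bar>Re \<beta>\<bar> + \<bar>B\<bar> * \<bar>Re s\<bar>" by (simp add: abs_mult [symmetric])
    also have "\<dots> \<le> K" unfolding K_def using s by (intro add_left_mono mult_left_mono) auto
    finally have "l \<le> nat \<lceil>K\<rceil>" by linarith
    moreover have "s = (- of_nat l - \<beta>) / of_real B"
      unfolding l[symmetric] using assms by simp
    ultimately show "s \<in> (\<lambda>l. (- of_nat l - \<beta>) / of_real B) ` {..nat \<lceil>K\<rceil>}" by auto
  qed
  then show ?thesis by (rule finite_subset) simp
qed

lemma pole_set_real:
  assumes "\<beta> \<in> \<real>" "B \<noteq> 0"
  shows "pole_set \<beta> B \<subseteq> \<real>"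
proof
  fix s assume "s \<in> pole_set \<beta> B"
  then obtain l :: nat where "\<beta> + of_real B * s = - of_nat l" by (rule pole_setE)
  then have "s = (- of_nat l - \<beta>) / of_real B" using assms(2) by (simp add: field_simps)
  with assms(1) show "s \<in> \<real>" by simp
qed

lemma pole_set_Re:
  assumes "s \<in> pole_set \<beta> B"
  shows "B > 0 \<Longrightarrow> Re s \<le> - Re \<beta> / B" "B < 0 \<Longrightarrow> Re \<beta> / (- B) \<le> Re s"
proof -
  obtain l :: nat where "\<beta> + of_real B * s = - of_nat l" using assms by (rule pole_setE)
  then have "Re (\<beta> + of_real B * s) = - real l" by simp
  then have "Re \<beta> + B * Re s \<le> 0" by simp
  then show "B > 0 \<Longrightarrow> Re s \<le> - Re \<beta> / B" "B < 0 \<Longrightarrow> Re \<beta> / (- B) \<le> Re s"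
    by (auto simp: field_simps)
qed

lemma fox_poles_disjoint:
  assumes "fox_defined m n as bs"
  shows "left_poles m bs \<inter> right_poles n as = {}"
proof -
  have False if sl: "s \<in> left_poles m bs" and sr: "s \<in> right_poles n as" for s
  proof -
    obtain \<beta> B where b: "(\<beta>, B) \<in> set (take m bs)" "s \<in> pole_set \<beta> B"
      using sl by (auto simp: left_poles_def)
    obtain \<alpha> A where a: "(\<alpha>, A) \<in> set (take n as)" "s \<in> pole_set (1 - \<alpha>) (- A)"
      using sr by (auto simp: right_poles_def)
    obtain l :: nat where l: "\<beta> + of_real B * s = - of_nat l" using b(2) by (rule pole_setE)
    obtain l' :: nat where l': "1 - \<alpha> + of_real (- A) * s = - of_nat l'" using a(2) by (rule pole_setE)
    \<comment> \<open>Eliminating \<open>s\<close> from the two pole equations yields exactly the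
      coincidence excluded by \<open>fox_defined\<close>.\<close>
    have "of_real A * (of_nat l + \<beta>) = of_real B * (\<alpha> - of_nat l' - 1)"
      using l l' by (simp add: of_real_minus) algebra
    then show False using assms a(1) b(1) unfolding fox_defined_def by blast
  qed
  then show ?thesis by blast
qed

definition fox_real :: "fox_params \<Rightarrow> bool" where
  "fox_real xs \<longleftrightarrow> (\<forall>(x, X) \<in> set xs. x \<in> \<real>)"

definition fox_poles :: "nat \<Rightarrow> nat \<Rightarrow> fox_params \<Rightarrow> fox_params \<Rightarrow> complex set" where
  "fox_poles m n as bs = left_poles m bs \<union> right_poles n as"

lemma fox_defined_pos:
  assumes "fox_defined m n as bs"
  shows "(\<beta>, B) \<in> set bs \<Longrightarrow> B > 0" "(\<alpha>, A) \<in> set as \<Longrightarrow> A > 0"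
  using assms by (auto simp: fox_defined_def)

lemma fox_poles_closed: "closed (fox_poles m n as bs)"
  unfolding fox_poles_def left_poles_def right_poles_def
  by (intro closed_Un closed_UN) (auto simp: closed_pole_set)

lemma fox_poles_locally_finite:
  assumes "fox_defined m n as bs"
  shows "finite {s \<in> fox_poles m n as bs. a \<le> Re s \<and> Re s \<le> b}"
proof -
  have "{s \<in> fox_poles m n as bs. a \<le> Re s \<and> Re s \<le> b}
    = (\<Union>(\<beta>, B) \<in> set (take m bs). {s \<in> pole_set \<beta> B. a \<le> Re s \<and> Re s \<le> b})
    \<union> (\<Union>(\<alpha>, A) \<in> set (take n as). {s \<in> pole_set (1 - \<alpha>) (- A). a \<le> Re s \<and> Re s \<le> b})"
    by (auto simp: fox_poles_def left_poles_def right_poles_def)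
  moreover have "finite {s \<in> pole_set \<beta> B. a \<le> Re s \<and> Re s \<le> b}" if "(\<beta>, B) \<in> set (take m bs)" for \<beta> B
    using fox_defined_pos(1)[OF assms in_set_takeD[OF that]] by (intro finite_pole_set_strip) simp
  moreover have "finite {s \<in> pole_set (1 - \<alpha>) (- A). a \<le> Re s \<and> Re s \<le> b}" if "(\<alpha>, A) \<in> set (take n as)" for \<alpha> A
    using fox_defined_pos(2)[OF assms in_set_takeD[OF that]] by (intro finite_pole_set_strip) simp
  ultimately show ?thesis by auto
qed

lemma left_poles_real:
  assumes "fox_defined m n as bs" "fox_real bs"
  shows "left_poles m bs \<subseteq> \<real>"
proof
  fix s assume "s \<in> left_poles m bs"
  then obtain \<beta> B where b: "(\<beta>, B) \<in> set (take m bs)" "s \<in> pole_set \<beta> B" by (auto simp: left_poles_def)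
  then have "\<beta> \<in> \<real>" "B > 0" using assms fox_defined_pos(1)[OF assms(1)]
    by (auto simp: fox_real_def dest: in_set_takeD)
  then show "s \<in> \<real>" using pole_set_real[of \<beta> B] b(2) by auto
qed

lemma right_poles_real:
  assumes "fox_defined m n as bs" "fox_real as"
  shows "right_poles n as \<subseteq> \<real>"
proof
  fix s assume "s \<in> right_poles n as"
  then obtain \<alpha> A where a: "(\<alpha>, A) \<in> set (take n as)" "s \<in> pole_set (1 - \<alpha>) (- A)" by (auto simp: right_poles_def)
  then have "\<alpha> \<in> \<real>" "A > 0" using assms fox_defined_pos(2)[OF assms(1)]
    by (auto simp: fox_real_def dest: in_set_takeD)
  then show "s \<in> \<real>" using pole_set_real[of "1 - \<alpha>" "- A"] a(2) by auto
qed

lemma right_poles_bounded_below: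
  assumes "fox_defined m n as bs"
  obtains lo where "\<And>s. s \<in> right_poles n as \<Longrightarrow> lo \<le> Re s"
proof -
  \<comment> \<open>The inserted 0 keeps \<open>S\<close> nonempty when \<open>n = 0\<close>; any
    lower bound will do.\<close>
  define S where "S = insert 0 ((\<lambda>(\<alpha>, A). Re (1 - \<alpha>) / A) ` set (take n as))"
  have "Min S \<le> Re s" if "s \<in> right_poles n as" for s
  proof -
    obtain \<alpha> A where a: "(\<alpha>, A) \<in> set (take n as)" "s \<in> pole_set (1 - \<alpha>) (- A)"
      using \<open>s \<in> right_poles n as\<close> by (auto simp: right_poles_def)
    have "A > 0" using fox_defined_pos(2)[OF assms in_set_takeD[OF a(1)]] .
    then have "Re (1 - \<alpha>) / A \<le> Re s" using pole_set_Re(2)[OF a(2)] by simp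
    moreover have "Min S \<le> Re (1 - \<alpha>) / A"
      using a(1) by (intro Min_le) (auto simp: S_def intro!: rev_image_eqI)
    ultimately show ?thesis by simp
  qed
  then show ?thesis using that by blast
qed

lemma left_poles_bounded_above:
  assumes def: "fox_defined m n as bs" and W: "\<And>\<beta> B. (\<beta>, B) \<in> set (take m bs) \<Longrightarrow> - Re \<beta> / B < W"
  obtains p where "p < W" "\<And>s. s \<in> left_poles m bs \<Longrightarrow> Re s \<le> p"
proof -
  \<comment> \<open>The inserted \<open>W - 1\<close> keeps \<open>S\<close> nonempty when
    \<open>m = 0\<close> and is itself below \<open>W\<close>.\<close>
  define S where "S = insert (W - 1) ((\<lambda>(\<beta>, B). - Re \<beta> / B) ` set (take m bs))"
  have "Re s \<le> Max S" if "s \<in> left_poles m bs" for s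
  proof -
    obtain \<beta> B where b: "(\<beta>, B) \<in> set (take m bs)" "s \<in> pole_set \<beta> B"
      using \<open>s \<in> left_poles m bs\<close> by (auto simp: left_poles_def)
    have "B > 0" using fox_defined_pos(1)[OF def in_set_takeD[OF b(1)]] .
    then have "Re s \<le> - Re \<beta> / B" using pole_set_Re(1)[OF b(2)] by simp
    also have "\<dots> \<le> Max S"
      using b(1) by (intro Max_ge) (auto simp: S_def intro!: rev_image_eqI)
    finally show ?thesis .
  qed
  moreover have "Max S < W"
  proof -
    have "finite S" "S \<noteq> {}" by (auto simp: S_def)
    then show ?thesis using W by (auto simp: S_def)
  qed
  ultimately show ?thesis using that by blast
qed

text \<open>With the entire function \<open>rGamma\<close> in place of division, the denominator
  visibly creates no poles, and both holomorphy and growth can be read off factor by factor.\<close>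

lemma fox_Xi_altdef:
  "fox_Xi m n as bs s =
     ((\<Prod>(\<beta>, B) \<leftarrow> take m bs. Gamma (\<beta> + of_real B * s)) *
      (\<Prod>(\<alpha>, A) \<leftarrow> take n as. Gamma ((1 - \<alpha>) + of_real (- A) * s))) *
     ((\<Prod>(\<beta>, B) \<leftarrow> drop m bs. rGamma ((1 - \<beta>) + of_real (- B) * s)) *
      (\<Prod>(\<alpha>, A) \<leftarrow> drop n as. rGamma (\<alpha> + of_real A * s)))"
proof -
  have inv: "(\<Prod>(x, X) \<leftarrow> xs. rGamma (g x X)) = inverse (\<Prod>(x, X) \<leftarrow> xs. Gamma (g x X))"
    for xs :: fox_params and g :: "complex \<Rightarrow> real \<Rightarrow> complex"
    by (induction xs) (auto simp: rGamma_inverse_Gamma)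
  show ?thesis unfolding fox_Xi_def inv by (simp add: divide_inverse)
qed

lemma holomorphic_on_prod_list:
  assumes "\<And>x. x \<in> set xs \<Longrightarrow> f x holomorphic_on S"
  shows "(\<lambda>s. \<Prod>x\<leftarrow>xs. f x s) holomorphic_on S"
  using assms by (induction xs) (auto intro!: holomorphic_intros)

lemma fox_Xi_holomorphic: "fox_Xi m n as bs holomorphic_on - fox_poles m n as bs"
proof -
  have G: "(\<lambda>s. \<Prod>x\<leftarrow>xs. case x of (x, X) \<Rightarrow> Gamma (h x + of_real (k X) * s)) holomorphic_on S"
    if "\<And>x X. (x, X) \<in> set xs \<Longrightarrow> S \<inter> pole_set (h x) (k X) = {}"
    for xs :: fox_params and h k S
    using that by (intro holomorphic_on_prod_list)
      (force simp: pole_set_def intro!: holomorphic_intros split: prod.splits)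
  have rG: "(\<lambda>s. \<Prod>x\<leftarrow>xs. case x of (x, X) \<Rightarrow> rGamma (h x + of_real (k X) * s)) holomorphic_on S"
    for xs :: fox_params and h k S
    by (intro holomorphic_on_prod_list) (auto intro!: holomorphic_intros split: prod.splits)
  have "(\<lambda>s. fox_Xi m n as bs s) holomorphic_on - fox_poles m n as bs"
    unfolding fox_Xi_altdef
    by (intro holomorphic_on_mult G rG; force simp: fox_poles_def left_poles_def right_poles_def)
  then show ?thesis by simp
qed

lemma strip_bound_prod_list:
  assumes "\<And>x. x \<in> set xs \<Longrightarrow> strip_bound (f x) (\<tau> x)"
  shows "strip_bound (\<lambda>s. \<Prod>x\<leftarrow>xs. f x s) (\<Sum>x\<leftarrow>xs. \<tau> x)"
  using assms by (induction xs) (auto intro!: strip_bound_mult strip_bound_1)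

lemma strip_bound_Gamma_affine:
  assumes "\<beta> \<in> \<real>" "B \<noteq> 0"
  shows "strip_bound (\<lambda>s. Gamma (\<beta> + of_real B * s)) (- pi / 2 * \<bar>B\<bar>)"
    and "strip_bound (\<lambda>s. rGamma (\<beta> + of_real B * s)) (pi / 2 * \<bar>B\<bar>)"
  using strip_bound_affine[OF strip_bound_Gamma assms(2), of "Re \<beta>"]
    strip_bound_affine[OF strip_bound_rGamma assms(2), of "Re \<beta>"] assms(1)
  by (simp_all add: mult.commute)

text \<open>Each numerator factor contributes \<open>- pi / 2\<close> times its coefficient to the
  exponent and each denominator factor \<open>pi / 2\<close> times its coefficient; the signs are
  those in \<open>fox_chi\<close>.\<close>

lemma fox_Xi_strip_bound:
  assumes def: "fox_defined m n as bs" and real: "fox_real as" "fox_real bs"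
  shows "strip_bound (fox_Xi m n as bs) (- pi / 2 * fox_chi m n as bs)"
proof -
  have b: "\<beta> \<in> \<real>" "B > 0" if "(\<beta>, B) \<in> set (take m bs) \<or> (\<beta>, B) \<in> set (drop m bs)" for \<beta> B
    using that real fox_defined_pos(1)[OF def] by (auto simp: fox_real_def dest!: in_set_takeD in_set_dropD)
  have a: "\<alpha> \<in> \<real>" "A > 0" if "(\<alpha>, A) \<in> set (take n as) \<or> (\<alpha>, A) \<in> set (drop n as)" for \<alpha> A
    using that real fox_defined_pos(2)[OF def] by (auto simp: fox_real_def dest!: in_set_takeD in_set_dropD)
  have 1: "strip_bound (\<lambda>s. \<Prod>(\<beta>, B) \<leftarrow> take m bs. Gamma (\<beta> + of_real B * s))
      (\<Sum>(\<beta>, B) \<leftarrow> take m bs. - pi / 2 * B)"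
  proof (rule strip_bound_prod_list, clarify)
    fix \<beta> B assume "(\<beta>, B) \<in> set (take m bs)"
    then show "strip_bound (\<lambda>s. Gamma (\<beta> + of_real B * s)) (- pi / 2 * B)"
      using strip_bound_Gamma_affine(1)[of \<beta> B] b[of \<beta> B] by simp
  qed
  have 2: "strip_bound (\<lambda>s. \<Prod>(\<alpha>, A) \<leftarrow> take n as. Gamma ((1 - \<alpha>) + of_real (- A) * s))
      (\<Sum>(\<alpha>, A) \<leftarrow> take n as. - pi / 2 * A)"
  proof (rule strip_bound_prod_list, clarify)
    fix \<alpha> A assume "(\<alpha>, A) \<in> set (take n as)"
    then show "strip_bound (\<lambda>s. Gamma ((1 - \<alpha>) + of_real (- A) * s)) (- pi / 2 * A)"
      using strip_bound_Gamma_affine(1)[of "1 - \<alpha>" "- A"] a[of \<alpha> A] by simp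
  qed
  have 3: "strip_bound (\<lambda>s. \<Prod>(\<beta>, B) \<leftarrow> drop m bs. rGamma ((1 - \<beta>) + of_real (- B) * s))
      (\<Sum>(\<beta>, B) \<leftarrow> drop m bs. pi / 2 * B)"
  proof (rule strip_bound_prod_list, clarify)
    fix \<beta> B assume "(\<beta>, B) \<in> set (drop m bs)"
    then show "strip_bound (\<lambda>s. rGamma ((1 - \<beta>) + of_real (- B) * s)) (pi / 2 * B)"
      using strip_bound_Gamma_affine(2)[of "1 - \<beta>" "- B"] b[of \<beta> B] by simp
  qed
  have 4: "strip_bound (\<lambda>s. \<Prod>(\<alpha>, A) \<leftarrow> drop n as. rGamma (\<alpha> + of_real A * s))
      (\<Sum>(\<alpha>, A) \<leftarrow> drop n as. pi / 2 * A)"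
  proof (rule strip_bound_prod_list, clarify)
    fix \<alpha> A assume "(\<alpha>, A) \<in> set (drop n as)"
    then show "strip_bound (\<lambda>s. rGamma (\<alpha> + of_real A * s)) (pi / 2 * A)"
      using strip_bound_Gamma_affine(2)[of \<alpha> A] a[of \<alpha> A] by simp
  qed
  have scale: "(\<Sum>(x, X) \<leftarrow> xs. c * X) = c * (\<Sum>(x, X) \<leftarrow> xs. X)" for xs :: fox_params and c
    by (induction xs) (auto simp: algebra_simps)
  have "strip_bound (\<lambda>s. fox_Xi m n as bs s)
     (((\<Sum>(\<beta>, B) \<leftarrow> take m bs. - pi / 2 * B) + (\<Sum>(\<alpha>, A) \<leftarrow> take n as. - pi / 2 * A)) +
      ((\<Sum>(\<beta>, B) \<leftarrow> drop m bs. pi / 2 * B) + (\<Sum>(\<alpha>, A) \<leftarrow> drop n as. pi / 2 * A)))"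
    unfolding fox_Xi_altdef by (intro strip_bound_mult 1 2 3 4)
  then show ?thesis
    unfolding scale fox_chi_def by (simp add: algebra_simps add_divide_distrib diff_divide_distrib)
qed

lemma strip_bound_powr:
  assumes "z > 0"
  shows "strip_bound (\<lambda>s. complex_of_real z powr (- s)) 0"
proof (rule strip_boundI)
  fix a b \<sigma> :: real assume \<sigma>: "0 < \<sigma>"
  have "norm (complex_of_real z powr (- s)) \<le> exp ((\<bar>a\<bar> + \<bar>b\<bar>) * \<bar>ln z\<bar>) * exp (\<sigma> * \<bar>Im s\<bar>)"
    if "a \<le> Re s" "Re s \<le> b" for s
  proof -
    have "norm (complex_of_real z powr (- s)) = exp (- Re s * ln z)"
      using assms by (simp add: norm_powr_real_powr powr_def)
    also have "- Re s * ln z \<le> \<bar>Re s\<bar> * \<bar>ln z\<bar>" by (metis abs_ge_self abs_minus abs_mult)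
    also have "\<dots> \<le> (\<bar>a\<bar> + \<bar>b\<bar>) * \<bar>ln z\<bar>" using that by (intro mult_right_mono) auto
    finally have "norm (complex_of_real z powr (- s)) \<le> exp ((\<bar>a\<bar> + \<bar>b\<bar>) * \<bar>ln z\<bar>) * 1" by simp
    also have "\<dots> \<le> exp ((\<bar>a\<bar> + \<bar>b\<bar>) * \<bar>ln z\<bar>) * exp (\<sigma> * \<bar>Im s\<bar>)" using \<sigma> by (intro mult_left_mono) auto
    finally show ?thesis .
  qed
  then show "\<exists>C T. \<forall>s. a \<le> Re s \<and> Re s \<le> b \<and> T \<le> \<bar>Im s\<bar> \<longrightarrow>
      norm (complex_of_real z powr (- s)) \<le> C * exp (\<sigma> * \<bar>Im s\<bar>)" by blast
qed

lemma strip_bound_imp_decay: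
  assumes "strip_bound f \<tau>" "\<tau> < 0"
  shows "strip_decay f"
  unfolding strip_decay_def
proof (rule exI[of _ "- \<tau> / 2"], intro conjI allI)
  show "- \<tau> / 2 > 0" using assms(2) by simp
  fix a b
  have "- \<tau> / 2 > 0" "\<tau> + - \<tau> / 2 = - (- \<tau> / 2)" using assms(2) by auto
  then show "\<exists>C T. \<forall>s. a \<le> Re s \<and> Re s \<le> b \<and> T \<le> \<bar>Im s\<bar> \<longrightarrow> norm (f s) \<le> C * exp (- (- \<tau> / 2) * \<bar>Im s\<bar>)"
    using assms(1) unfolding strip_bound_def by metis
qed

lemma fox_integrand_decay:
  assumes "fox_defined m n as bs" "fox_real as" "fox_real bs" "fox_chi m n as bs > 0" "z > 0"
  shows "strip_decay (\<lambda>s. fox_Xi m n as bs s * complex_of_real z powr (- s))"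
  using strip_bound_mult0[OF fox_Xi_strip_bound[OF assms(1-3)] strip_bound_powr[OF assms(5)]] assms(4)
  by (intro strip_bound_imp_decay) auto

text \<open>One admissible contour makes the contour selected by \<open>SOME\<close> admissible too,
  and independence of the contour then trades it for \<open>c\<close>.\<close>

lemma fox_H_eq:
  assumes def: "fox_defined m n as bs" "fox_real as" "fox_real bs" "fox_chi m n as bs > 0" "z > 0"
    and c: "fox_contour m n as bs c"
  shows "fox_H m n as bs z = 1 / (2 * of_real pi * \<i>) *
     integral UNIV (\<lambda>t. fox_Xi m n as bs (c t) * complex_of_real z powr (- c t) * vector_derivative c (at t))"
proof -
  define c' where "c' = (SOME c. fox_contour m n as bs c)"
  have c': "fox_contour m n as bs c'" unfolding c'_def using c by (metis someI)
  obtain \<gamma> \<gamma>' where \<gamma>: "vertical_contour \<gamma> c" "vertical_contour \<gamma>' c'"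
    using c c' by (auto simp: fox_contour_iff)
  have "integral UNIV (\<lambda>t. fox_Xi m n as bs (c' t) * complex_of_real z powr (- c' t) * vector_derivative c' (at t))
      = integral UNIV (\<lambda>t. fox_Xi m n as bs (c t) * complex_of_real z powr (- c t) * vector_derivative c (at t))"
  proof (rule vertical_contours_integral_eq[OF \<gamma>(2,1) fox_poles_closed fox_poles_locally_finite[OF def(1)]
        fox_poles_def])
    show "(\<lambda>s. fox_Xi m n as bs s * complex_of_real z powr (- s)) holomorphic_on - fox_poles m n as bs"
      by (intro holomorphic_intros fox_Xi_holomorphic[THEN holomorphic_on_subset]) (use def(5) in auto)
    show "strip_decay (\<lambda>s. fox_Xi m n as bs s * complex_of_real z powr (- s))"
      by (rule fox_integrand_decay[OF def])
  qed (use c c' in \<open>auto simp: fox_contour_iff\<close>)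
  then show ?thesis unfolding fox_H_def Let_def c'_def[symmetric] by simp
qed

section \<open>Mellin transforms along a contour\<close>

text \<open>
  The integrand \<open>u powr (z - 1) * exp (- u)\<close> of the Gamma integral on the positive half-line.
\<close>

definition mellin_kernel :: "complex \<Rightarrow> real \<Rightarrow> complex" where
  "mellin_kernel z u = indicator {0<..} u *\<^sub>R (exp ((z - 1) * of_real (ln u)) / of_real (exp u))"

lemma mellin_kernel_measurable [measurable]:
  assumes [measurable]: "f \<in> borel_measurable M" "g \<in> borel_measurable M"
  shows "(\<lambda>x. mellin_kernel (f x) (g x)) \<in> borel_measurable M"
  unfolding mellin_kernel_def by measurable

lemma mellin_kernel_integral:
  assumes "Re z > 0"
  shows "integrable lborel (mellin_kernel z)" "integral\<^sup>L lborel (mellin_kernel z) = Gamma z"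
proof -
  have eq: "mellin_kernel z u = indicator {0<..} u *\<^sub>R (of_real u powr (z - 1) / of_real (exp u))" for u
    by (auto simp: mellin_kernel_def powr_def Ln_of_real indicator_def)
  have meas: "mellin_kernel z \<in> borel_measurable lborel" by measurable
  have "integrable lebesgue (mellin_kernel z)"
    using absolutely_integrable_Gamma_integral'[OF assms] unfolding set_integrable_def eq[abs_def] .
  then show int: "integrable lborel (mellin_kernel z)"
    using integrable_completion[OF meas] by simp
  have "(mellin_kernel z has_integral integral\<^sup>L lborel (mellin_kernel z)) UNIV"
    using int by (rule has_integral_integral_lborel)
  moreover have "(mellin_kernel z has_integral Gamma z) UNIV"
  proof -
    have "mellin_kernel z = (\<lambda>u. if u \<in> {0<..} then of_real u powr (z - 1) / of_real (exp u) else 0)"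
      by (auto simp: eq indicator_def)
    then show ?thesis using Gamma_integral_complex'[OF assms] by (simp only: has_integral_restrict_UNIV)
  qed
  ultimately show "integral\<^sup>L lborel (mellin_kernel z) = Gamma z" by (rule has_integral_unique)
qed

text \<open>Phrased in the complex numbers so that the absolute integral becomes a Gamma integral
  again, now at the real part.\<close>

lemma norm_mellin_kernel: "complex_of_real (norm (mellin_kernel z u)) = mellin_kernel (of_real (Re z)) u"
proof (cases "u > 0")
  case True
  then have "norm (mellin_kernel z u) = exp ((Re z - 1) * ln u) / exp u"
    by (simp add: mellin_kernel_def norm_divide)
  then show ?thesis using True by (simp add: mellin_kernel_def exp_of_real [symmetric])
qed (simp add: mellin_kernel_def)

lemma mellin_kernel_norm_integral:
  assumes "Re z > 0"
  shows "integral\<^sup>L lborel (\<lambda>u. norm (mellin_kernel z u)) = Gamma (Re z)"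
proof -
  have "complex_of_real (integral\<^sup>L lborel (\<lambda>u. norm (mellin_kernel z u)))
      = integral\<^sup>L lborel (mellin_kernel (of_real (Re z)))"
    by (simp add: norm_mellin_kernel flip: integral_complex_of_real)
  also have "\<dots> = of_real (Gamma (Re z))"
    using mellin_kernel_integral(2)[of "of_real (Re z)"] assms by (simp add: Gamma_complex_of_real)
  finally show ?thesis by (simp only: of_real_eq_iff)
qed

section \<open>Lebesgue integrals and Fubini's theorem along a contour\<close>

lemma integrable_exp_decay:
  fixes g d :: "real \<Rightarrow> complex"
  assumes g: "continuous_on UNIV g" and \<epsilon>: "\<epsilon> > 0"
    and tail: "\<And>t. \<bar>t\<bar> \<ge> T \<Longrightarrow> norm (g t) \<le> C * exp (- \<epsilon> * \<bar>t\<bar>)"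
    and d: "d \<in> borel_measurable borel" "\<And>t. norm (d t) \<le> K"
  shows "integrable lborel (\<lambda>t. g t * d t)"
proof -
  have "compact (g ` {- \<bar>T\<bar>..\<bar>T\<bar>})"
    by (intro compact_continuous_image continuous_on_subset[OF g]) auto
  then obtain B where B: "\<And>t. t \<in> {- \<bar>T\<bar>..\<bar>T\<bar>} \<Longrightarrow> norm (g t) \<le> B"
    by (meson bounded_iff compact_imp_bounded image_eqI)
  \<comment> \<open>On the central interval \<open>exp (- \<epsilon> * \<bar>t\<bar>)\<close> can be
    as small as \<open>exp (- \<epsilon> * \<bar>T\<bar>)\<close>, which the second factor
    compensates.\<close>
  define M where "M = max \<bar>C\<bar> (\<bar>B\<bar> * exp (\<epsilon> * \<bar>T\<bar>))"
  have bound: "norm (g t) \<le> M * exp (- \<epsilon> * \<bar>t\<bar>)" for t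
  proof (cases "\<bar>t\<bar> \<ge> T")
    case True
    then have "norm (g t) \<le> C * exp (- \<epsilon> * \<bar>t\<bar>)" by (rule tail)
    also have "\<dots> \<le> M * exp (- \<epsilon> * \<bar>t\<bar>)" by (intro mult_right_mono) (auto simp: M_def)
    finally show ?thesis .
  next
    case False
    then have "t \<in> {- \<bar>T\<bar>..\<bar>T\<bar>}" by auto
    then have "norm (g t) \<le> \<bar>B\<bar> * 1" using B[of t] by linarith
    also have "\<dots> \<le> \<bar>B\<bar> * (exp (\<epsilon> * \<bar>T\<bar>) * exp (- \<epsilon> * \<bar>t\<bar>))"
      using False \<epsilon> by (intro mult_left_mono) (auto simp: exp_add [symmetric] algebra_simps)
    also have "\<dots> \<le> M * exp (- \<epsilon> * \<bar>t\<bar>)"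
      unfolding mult.assoc [symmetric] by (intro mult_right_mono) (auto simp: M_def)
    finally show ?thesis .
  qed
  have [measurable]: "g \<in> borel_measurable borel" using g by (rule borel_measurable_continuous_onI)
  note d(1) [measurable]
  have "integrable lebesgue (\<lambda>t. exp (- \<epsilon> * \<bar>t\<bar>))"
    using nonnegative_absolutely_integrable_1[OF exp_decay_integrable[OF \<epsilon>]]
    by (simp add: set_integrable_def)
  then have "integrable lborel (\<lambda>t. exp (- \<epsilon> * \<bar>t\<bar>))"
    by (subst (asm) integrable_completion) auto
  then have "integrable lborel (\<lambda>t. (\<bar>M\<bar> * \<bar>K\<bar>) * exp (- \<epsilon> * \<bar>t\<bar>))"
    by (rule integrable_mult_right)
  then show ?thesis
  proof (rule Bochner_Integration.integrable_bound)
    show "AE t in lborel. norm (g t * d t) \<le> norm ((\<bar>M\<bar> * \<bar>K\<bar>) * exp (- \<epsilon> * \<bar>t\<bar>))"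
    proof (rule AE_I2)
      fix t
      have "norm (g t * d t) \<le> (\<bar>M\<bar> * exp (- \<epsilon> * \<bar>t\<bar>)) * \<bar>K\<bar>"
        unfolding norm_mult
      proof (intro mult_mono)
        have "norm (g t) \<le> M * exp (- \<epsilon> * \<bar>t\<bar>)" by (rule bound)
        also have "\<dots> \<le> \<bar>M\<bar> * exp (- \<epsilon> * \<bar>t\<bar>)" by (intro mult_right_mono) auto
        finally show "norm (g t) \<le> \<bar>M\<bar> * exp (- \<epsilon> * \<bar>t\<bar>)" .
      qed (use d(2)[of t] in auto)
      then show "norm (g t * d t) \<le> norm ((\<bar>M\<bar> * \<bar>K\<bar>) * exp (- \<epsilon> * \<bar>t\<bar>))"
        by (simp add: abs_mult mult_ac)
    qed
  qed measurable
qed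

text \<open>Passes from the gauge integral in \<open>fox_H\<close> to a Lebesgue integral over an
  explicit derivative, the form that Fubini's theorem requires.\<close>

lemma integral_spike_vector_derivative:
  fixes g c d :: "real \<Rightarrow> complex"
  assumes "integrable lborel (\<lambda>t. g t * d t)" "finite F"
    and "\<And>t. t \<notin> F \<Longrightarrow> (c has_vector_derivative d t) (at t)"
  shows "integral UNIV (\<lambda>t. g t * vector_derivative c (at t)) = integral\<^sup>L lborel (\<lambda>t. g t * d t)"
proof (rule integral_unique)
  show "((\<lambda>t. g t * vector_derivative c (at t)) has_integral integral\<^sup>L lborel (\<lambda>t. g t * d t)) UNIV"
    by (rule has_integral_spike_finite[OF assms(2) _ has_integral_integral_lborel[OF assms(1)]])
      (use assms(3) vector_derivative_at in auto)
qed

text \<open>A zero integral would make the nonnegative integrand vanish almost everywhere, but it is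
  positive on the unit interval.\<close>

lemma integral_pos_halfline:
  fixes \<phi> :: "real \<Rightarrow> real"
  assumes int: "integrable lborel (\<lambda>u. indicator {0<..} u * \<phi> u)" and pos: "\<And>u. u > 0 \<Longrightarrow> \<phi> u > 0"
  shows "integral\<^sup>L lborel (\<lambda>u. indicator {0<..} u * \<phi> u) > 0"
proof -
  have nonneg: "0 \<le> indicator {0<..} u * \<phi> u" for u
    using pos[of u] by (auto simp: indicator_def less_imp_le)
  have "integral\<^sup>L lborel (\<lambda>u. indicator {0<..} u * \<phi> u) \<noteq> 0"
  proof
    assume "integral\<^sup>L lborel (\<lambda>u. indicator {0<..} u * \<phi> u) = 0"
    then have "AE u in lborel. indicator {0<..} u * \<phi> u = 0"
      using integral_nonneg_eq_0_iff_AE[OF int] nonneg by simp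
    then have "AE u in lborel. u \<notin> {0<..<1::real}"
      by eventually_elim (use pos in \<open>force simp: indicator_def\<close>)
    then have "emeasure lborel {0<..<1::real} = 0"
      by (subst (asm) AE_iff_measurable[of "{0<..<1}"]) auto
    then show False by simp
  qed
  moreover have "0 \<le> integral\<^sup>L lborel (\<lambda>u. indicator {0<..} u * \<phi> u)"
    using nonneg by (intro integral_nonneg_AE) simp
  ultimately show ?thesis by simp
qed

lemma powr_of_real_eq_exp:
  "x > 0 \<Longrightarrow> complex_of_real x powr w = exp (w * of_real (ln x))"
  by (simp add: powr_def Ln_of_real)

text \<open>The part of the kernel that depends on \<open>s\<close> is
  \<open>u powr (- lam * s)\<close>. It joins the power of \<open>z\<close>, so that after the
  exchange the inner integral is the old one at \<open>z * u powr lam\<close>.\<close>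

lemma mellin_kernel_shift:
  assumes "z > 0" "u > 0"
  shows "complex_of_real z powr (- s) * mellin_kernel (of_real \<omega> - of_real lam * s) u
       = mellin_kernel (of_real \<omega>) u * complex_of_real (z * u powr lam) powr (- s)"
proof -
  have "complex_of_real z powr (- s) = exp (- s * of_real (ln z))"
    using assms by (simp add: powr_of_real_eq_exp)
  moreover have "complex_of_real (z * u powr lam) powr (- s) = exp (- s * of_real (ln z + lam * ln u))"
  proof -
    have pos: "z * u powr lam > 0" using assms by simp
    have "ln (z * u powr lam) = ln z + lam * ln u" using assms by (simp add: ln_mult ln_powr)
    then show ?thesis by (simp only: powr_of_real_eq_exp[OF pos])
  qed
  moreover have "exp (- s * of_real (ln z)) * exp ((of_real \<omega> - of_real lam * s - 1) * of_real (ln u))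
      = exp ((of_real \<omega> - 1) * of_real (ln u)) * exp (- s * of_real (ln z + lam * ln u))"
    unfolding exp_add [symmetric] by (rule arg_cong[of _ _ exp]) (simp add: algebra_simps)
  ultimately show ?thesis using assms by (simp add: mellin_kernel_def)
qed

text \<open>Integrating the norm of the kernel over \<open>u\<close> gives Gamma at
  \<open>\<omega> - lam * Re (c t)\<close>, which is continuous in \<open>t\<close> and constant on
  the vertical tails. The decay of \<open>g\<close> therefore carries the absolute integrability on
  the product space.\<close>

lemma mellin_swap:
  fixes g c d :: "real \<Rightarrow> complex" and \<omega> lam z :: real
  assumes c: "continuous_on UNIV c" "\<And>t. \<bar>t\<bar> \<ge> T \<Longrightarrow> c t = Complex \<gamma> t"
    and g: "continuous_on UNIV g" "\<And>t. \<bar>t\<bar> \<ge> T \<Longrightarrow> norm (g t) \<le> C * exp (- \<epsilon> * \<bar>t\<bar>)"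
    and \<epsilon>: "\<epsilon> > 0" and d: "d \<in> borel_measurable borel" "\<And>t. norm (d t) \<le> K"
    and Re: "\<And>t. \<omega> - lam * Re (c t) > 0" and z: "z > 0"
  defines "I \<equiv> (\<lambda>y. integral\<^sup>L lborel (\<lambda>t. g t * complex_of_real y powr (- c t) * d t))"
  shows "integrable lborel (\<lambda>t. (Gamma (of_real \<omega> - of_real lam * c t) * g t) * complex_of_real z powr (- c t) * d t)"
      (is ?int1)
    and "integrable lborel (\<lambda>u. mellin_kernel (of_real \<omega>) u * I (z * u powr lam))" (is ?int2)
    and "integral\<^sup>L lborel (\<lambda>t. (Gamma (of_real \<omega> - of_real lam * c t) * g t) * complex_of_real z powr (- c t) * d t)
       = integral\<^sup>L lborel (\<lambda>u. mellin_kernel (of_real \<omega>) u * I (z * u powr lam))" (is ?eq)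
proof -
  define G where "G t = g t * complex_of_real z powr (- c t) * d t" for t
  define f where "f = (\<lambda>(t, u). G t * mellin_kernel (of_real \<omega> - of_real lam * c t) u)"
  have [measurable]: "c \<in> borel_measurable borel" "g \<in> borel_measurable borel"
    using c(1) g(1) by (auto intro: borel_measurable_continuous_onI)
  note d(1) [measurable]
  have zc: "continuous_on UNIV (\<lambda>t. complex_of_real z powr (- c t))"
    using z by (intro continuous_intros c(1)) auto
  have [measurable]: "(\<lambda>t. complex_of_real z powr (- c t)) \<in> borel_measurable borel"
    using zc by (rule borel_measurable_continuous_onI)
  have [measurable]: "G \<in> borel_measurable borel" unfolding G_def by measurable
  have f_meas: "f \<in> borel_measurable (lborel \<Otimes>\<^sub>M lborel)"
    unfolding f_def by measurable
  have ker: "Re (of_real \<omega> - of_real lam * c t) > 0" for t using Re[of t] by simp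
  have f_u: "integrable lborel (\<lambda>u. f (t, u))" for t
    using mellin_kernel_integral(1)[OF ker] by (simp add: f_def)
  have f_u_int: "integral\<^sup>L lborel (\<lambda>u. f (t, u)) = G t * Gamma (of_real \<omega> - of_real lam * c t)" for t
    using mellin_kernel_integral[OF ker] by (simp add: f_def)
  have f_u_norm: "integral\<^sup>L lborel (\<lambda>u. norm (f (t, u))) = norm (G t) * Gamma (\<omega> - lam * Re (c t))" for t
    using mellin_kernel_norm_integral[OF ker, of t] by (simp add: f_def norm_mult)
  have "integrable lborel (\<lambda>t. integral\<^sup>L lborel (\<lambda>u. norm (f (t, u))))"
  proof -
    define g' where "g' t = g t * complex_of_real z powr (- c t) * of_real (Gamma (\<omega> - lam * Re (c t)))" for t
    have Gc: "continuous_on UNIV (\<lambda>t. Gamma (\<omega> - lam * Re (c t)))"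
    proof (rule continuous_on_compose2[of "{0<..}" Gamma])
      show "continuous_on {0<..} (Gamma :: real \<Rightarrow> real)"
        by (intro continuous_on_Gamma) (auto elim!: nonpos_Ints_cases)
      show "continuous_on UNIV (\<lambda>t. \<omega> - lam * Re (c t))" by (intro continuous_intros c(1))
    qed (use Re in auto)
    have "integrable lborel (\<lambda>t. g' t * d t)"
    proof (rule integrable_exp_decay[OF _ \<epsilon> _ d])
      show "continuous_on UNIV g'"
        unfolding g'_def by (intro continuous_intros g(1) zc Gc)
      fix t assume t: "\<bar>t\<bar> \<ge> T"
      define L where "L = norm (complex_of_real z powr (- c t)) * \<bar>Gamma (\<omega> - lam * Re (c t))\<bar>"
      have L: "L = z powr (- \<gamma>) * \<bar>Gamma (\<omega> - lam * \<gamma>)\<bar>"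
        using c(2)[OF t] z by (simp add: L_def norm_powr_real_powr)
      have "norm (g' t) = norm (g t) * L" by (simp add: g'_def L_def norm_mult)
      also have "\<dots> \<le> (C * exp (- \<epsilon> * \<bar>t\<bar>)) * L"
        using g(2)[OF t] by (intro mult_right_mono) (auto simp: L_def)
      finally show "norm (g' t) \<le> (C * (z powr (- \<gamma>) * \<bar>Gamma (\<omega> - lam * \<gamma>)\<bar>)) * exp (- \<epsilon> * \<bar>t\<bar>)"
        by (simp add: L mult_ac)
    qed
    then have "integrable lborel (\<lambda>t. norm (g' t * d t))" by (rule integrable_norm)
    moreover have "norm (g' t * d t) = norm (G t) * Gamma (\<omega> - lam * Re (c t))" for t
      using Gamma_real_pos[OF Re[of t]] by (simp add: g'_def G_def norm_mult)
    ultimately show ?thesis by (simp add: f_u_norm)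
  qed
  then have f_int: "integrable (lborel \<Otimes>\<^sub>M lborel) f"
    using f_u by (intro lborel_pair.Fubini_integrable f_meas) auto
  have f_t_int: "integral\<^sup>L lborel (\<lambda>t. f (t, u)) = mellin_kernel (of_real \<omega>) u * I (z * u powr lam)" for u
  proof (cases "u > 0")
    case True
    have "f (t, u) = mellin_kernel (of_real \<omega>) u * (g t * complex_of_real (z * u powr lam) powr (- c t) * d t)" for t
      using mellin_kernel_shift[OF z True, of "c t" \<omega> lam] by (simp add: f_def G_def mult_ac)
    then show ?thesis by (simp add: I_def)
  next
    case False
    then show ?thesis by (simp add: f_def mellin_kernel_def)
  qed
  have comm: "G t * Gamma (of_real \<omega> - of_real lam * c t)
      = (Gamma (of_real \<omega> - of_real lam * c t) * g t) * complex_of_real z powr (- c t) * d t" for t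
    by (simp add: G_def mult_ac)
  show ?int1 using lborel_pair.integrable_fst'[OF f_int] unfolding f_u_int comm .
  have f_int': "integrable (lborel \<Otimes>\<^sub>M lborel) (\<lambda>(t, u). f (t, u))" using f_int by simp
  show ?int2 using lborel_pair.integrable_snd[OF f_int'] unfolding f_t_int .
  show ?eq using lborel_pair.Fubini_integral[OF f_int'] unfolding f_u_int f_t_int comm by simp
qed

section \<open>Prepending a pair of parameters\<close>

lemma fox_Xi_Cons:
  "fox_Xi m (Suc n) ((\<alpha>, A) # as) bs s = Gamma (1 - \<alpha> - of_real A * s) * fox_Xi m n as bs s"
  by (simp add: fox_Xi_def)

lemma right_poles_Cons: "right_poles (Suc n) ((\<alpha>, A) # as) = pole_set (1 - \<alpha>) (- A) \<union> right_poles n as"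
  by (simp add: right_poles_def)

lemma fox_chi_Cons: "fox_chi m (Suc n) ((\<alpha>, A) # as) bs = A + fox_chi m n as bs"
  by (simp add: fox_chi_def)

lemma fox_real_Cons: "fox_real ((\<alpha>, A) # as) \<longleftrightarrow> \<alpha> \<in> \<real> \<and> fox_real as"
  by (simp add: fox_real_def)

text \<open>The leftmost new pole \<open>\<omega> / lam\<close> lies strictly right of all left
  poles. In real parts, a coincidence would make
  \<open>lam * l + B * l' + B * (\<omega> + lam * (Re \<beta> / B))\<close> zero, although the last
  summand is positive and the others are nonnegative.\<close>

lemma fox_defined_Cons:
  assumes def: "fox_defined m n as bs" and real: "fox_real bs" and lam: "lam > 0"
    and \<omega>: "\<And>\<beta> B. (\<beta>, B) \<in> set (take m bs) \<Longrightarrow> \<omega> + lam * (Re \<beta> / B) > 0"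
  shows "fox_defined m (Suc n) ((of_real (1 - \<omega>), lam) # as) bs"
proof -
  have "of_real lam * (of_nat l + \<beta>) \<noteq> of_real B * (of_real (1 - \<omega>) - of_nat l' - 1)"
    if b: "(\<beta>, B) \<in> set (take m bs)" for \<beta> B and l l' :: nat
  proof
    assume eq: "of_real lam * (of_nat l + \<beta>) = of_real B * (of_real (1 - \<omega>) - of_nat l' - (1 :: complex))"
    have "B > 0" using fox_defined_pos(1)[OF def in_set_takeD[OF b]] .
    have "lam * (real l + Re \<beta>) = B * ((1 - \<omega>) - real l' - 1)"
      using arg_cong[OF eq, of Re] by simp
    then have "lam * real l + B * real l' + B * (\<omega> + lam * (Re \<beta> / B)) = 0"
    proof -
      have "B * (lam * (Re \<beta> / B)) = lam * Re \<beta>" using \<open>B > 0\<close> by simp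
      then show ?thesis using \<open>lam * (real l + Re \<beta>) = _\<close> by (simp add: algebra_simps)
    qed
    moreover have "B * (\<omega> + lam * (Re \<beta> / B)) > 0" using \<omega>[OF b] \<open>B > 0\<close> by simp
    moreover have "lam * real l \<ge> 0" "B * real l' \<ge> 0" using lam \<open>B > 0\<close> by auto
    ultimately show False by linarith
  qed
  then show ?thesis using def lam unfolding fox_defined_def by force
qed

lemma fox_H_Cons_positive:
  fixes \<omega> lam :: real
  assumes def: "fox_defined m n as bs" and real: "fox_real as" "fox_real bs"
    and chi: "fox_chi m n as bs > 0"
    and pos: "\<And>t. t > 0 \<Longrightarrow> positive_complex (fox_H m n as bs t)"
    and lam: "lam > 0"
    and \<omega>: "\<And>\<beta> B. (\<beta>, B) \<in> set (take m bs) \<Longrightarrow> \<omega> + lam * (Re \<beta> / B) > 0"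
    and z: "z > 0"
  shows "positive_complex (fox_H m (Suc n) ((of_real (1 - \<omega>), lam) # as) bs z)"
proof -
  define new where "new = (complex_of_real (1 - \<omega>), lam) # as"
  have new: "fox_defined m (Suc n) new bs" "fox_real new" "fox_chi m (Suc n) new bs > 0"
    using fox_defined_Cons[OF def real(2) lam \<omega>] real chi lam
    by (auto simp: new_def fox_chi_Cons fox_real_Cons)
  have PR: "right_poles n as \<subseteq> right_poles (Suc n) new" by (simp add: new_def right_poles_Cons)
  \<comment> \<open>The bound \<open>\<omega> / lam\<close> is both the leftmost new pole and the
    abscissa below which the Gamma integral converges.\<close>
  obtain p where p: "p < \<omega> / lam" "\<And>s. s \<in> left_poles m bs \<Longrightarrow> Re s \<le> p"
  proof (rule left_poles_bounded_above[OF def])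
    fix \<beta> B assume b: "(\<beta>, B) \<in> set (take m bs)"
    show "- Re \<beta> / B < \<omega> / lam" using \<omega>[OF b] lam by (simp add: field_simps)
  qed (rule that)
  obtain lo where lo: "\<And>s. s \<in> right_poles (Suc n) new \<Longrightarrow> lo \<le> Re s"
    using right_poles_bounded_below[OF new(1)] by blast
  obtain \<gamma> c d K F where c: "vertical_contour \<gamma> c" "left_poles m bs \<subseteq> left_side c"
      "right_poles (Suc n) new \<subseteq> right_side c" "\<And>t. Re (c t) < \<omega> / lam"
    and d: "finite F" "\<And>t. t \<notin> F \<Longrightarrow> (c has_vector_derivative d t) (at t)"
      "d \<in> borel_measurable borel" "\<And>t. norm (d t) \<le> K"
    by (rule separating_contour_exists[OF left_poles_real[OF new(1) real(2)] right_poles_real[OF new(1,2)]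
        fox_poles_disjoint[OF new(1)] fox_poles_locally_finite[OF new(1), unfolded fox_poles_def] p(2) lo p(1)])
      (assumption, assumption, rule that)
  have contours: "fox_contour m n as bs c" "fox_contour m (Suc n) new bs c"
    using c(1-3) PR by (auto simp: fox_contour_iff)
  obtain T0 where T0: "\<And>t. \<bar>t\<bar> \<ge> T0 \<Longrightarrow> c t = Complex \<gamma> t"
    using c(1) by (auto simp: vertical_contour_def)
  have "strip_decay (fox_Xi m n as bs)"
    by (rule strip_bound_imp_decay[OF fox_Xi_strip_bound[OF def real]]) (use chi in simp)
  then obtain \<epsilon> where \<epsilon>: "\<epsilon> > 0" "\<And>a b. \<exists>C T. \<forall>s. a \<le> Re s \<and> Re s \<le> b \<and> T \<le> \<bar>Im s\<bar> \<longrightarrow>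
      norm (fox_Xi m n as bs s) \<le> C * exp (- \<epsilon> * \<bar>Im s\<bar>)"
    unfolding strip_decay_def by blast
  obtain C T1 where T1: "\<And>s. Re s = \<gamma> \<Longrightarrow> T1 \<le> \<bar>Im s\<bar> \<Longrightarrow> norm (fox_Xi m n as bs s) \<le> C * exp (- \<epsilon> * \<bar>Im s\<bar>)"
    using \<epsilon>(2)[of \<gamma> \<gamma>] by auto
  define T where "T = max T0 T1"
  define g where "g t = fox_Xi m n as bs (c t)" for t
  have c_cont: "continuous_on UNIV c" by (rule vertical_contour_continuous[OF c(1)])
  have tail: "c t = Complex \<gamma> t" "norm (g t) \<le> C * exp (- \<epsilon> * \<bar>t\<bar>)" if "\<bar>t\<bar> \<ge> T" for t
    using T0[of t] T1[of "c t"] that by (auto simp: T_def g_def)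
  have "c t \<notin> fox_poles m n as bs" for t
  proof -
    have "c t \<in> range c" by simp
    then have "c t \<notin> left_side c" "c t \<notin> right_side c" using side_disjoint_range[of c] by blast+
    then show ?thesis using c(2,3) PR unfolding fox_poles_def by blast
  qed
  then have g_cont: "continuous_on UNIV g"
    unfolding g_def
    by (intro continuous_on_compose2[OF holomorphic_on_imp_continuous_on[OF fox_Xi_holomorphic] c_cont]) auto
  have Re: "\<omega> - lam * Re (c t) > 0" for t using c(4)[of t] lam by (simp add: field_simps)
  define I where "I y = integral\<^sup>L lborel (\<lambda>t. g t * complex_of_real y powr (- c t) * d t)" for y
  note swap = mellin_swap[OF c_cont tail(1) g_cont tail(2) \<epsilon>(1) d(3,4) Re z, folded I_def]
  define h where "h y = Re (fox_H m n as bs y)" for y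
  \<comment> \<open>On this contour the old function is \<open>I y\<close> divided by
    \<open>2 * pi * \<i>\<close>, so its positivity makes \<open>I y\<close> a positive multiple of
    \<open>2 * pi * \<i>\<close>; the prefactor of the new function removes that constant
    again.\<close>
  have I_eq: "I y = 2 * of_real pi * \<i> * of_real (h y)" and h_pos: "h y > 0" if y: "y > 0" for y
  proof -
    have "integrable lborel (\<lambda>t. (g t * complex_of_real y powr (- c t)) * d t)"
    proof (rule integrable_exp_decay[OF _ \<epsilon>(1) _ d(3,4)])
      show "continuous_on UNIV (\<lambda>t. g t * complex_of_real y powr (- c t))"
        using y by (intro continuous_intros g_cont c_cont) auto
      fix t assume t: "\<bar>t\<bar> \<ge> T"
      have "norm (g t * complex_of_real y powr (- c t)) = norm (g t) * y powr (- \<gamma>)"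
        using tail(1)[OF t] y by (simp add: norm_mult norm_powr_real_powr)
      also have "\<dots> \<le> (C * exp (- \<epsilon> * \<bar>t\<bar>)) * y powr (- \<gamma>)"
        using tail(2)[OF t] by (intro mult_right_mono) auto
      finally show "norm (g t * complex_of_real y powr (- c t)) \<le> (C * y powr (- \<gamma>)) * exp (- \<epsilon> * \<bar>t\<bar>)"
        by (simp add: mult_ac)
    qed
    from integral_spike_vector_derivative[OF this d(1,2)]
    have "fox_H m n as bs y = 1 / (2 * of_real pi * \<i>) * I y"
      using fox_H_eq[OF def real chi y contours(1)] by (simp add: I_def g_def)
    moreover have "fox_H m n as bs y = of_real (h y)" "h y > 0"
      using pos[OF y] by (auto simp: positive_complex_def h_def)
    ultimately show "I y = 2 * of_real pi * \<i> * of_real (h y)" "h y > 0"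
      by (simp_all add: field_simps)
  qed
  define \<phi> where "\<phi> u = exp ((\<omega> - 1) * ln u) / exp u * h (z * u powr lam)" for u
  have conv: "mellin_kernel (of_real \<omega>) u * I (z * u powr lam)
      = 2 * of_real pi * \<i> * of_real (indicator {0<..} u * \<phi> u)" for u
  proof (cases "u > 0")
    case True
    then have "z * u powr lam > 0" using z by simp
    from I_eq[OF this] True show ?thesis
      by (simp add: mellin_kernel_def \<phi>_def exp_of_real [symmetric])
  qed (simp add: mellin_kernel_def)
  have \<phi>_int: "integrable lborel (\<lambda>u. indicator {0<..} u * \<phi> u)"
  proof -
    have "integrable lborel (\<lambda>u. complex_of_real (indicator {0<..} u * \<phi> u))"
      using integrable_mult_right[OF swap(2)[unfolded conv], of "1 / (2 * of_real pi * \<i>)"]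
      by (simp add: mult.assoc [symmetric] del: of_real_mult)
    from integrable_Re[OF this] show ?thesis by (simp only: Re_complex_of_real)
  qed
  have \<phi>_pos: "integral\<^sup>L lborel (\<lambda>u. indicator {0<..} u * \<phi> u) > 0"
  proof (rule integral_pos_halfline[OF \<phi>_int])
    fix u :: real assume "u > 0"
    then show "\<phi> u > 0" using h_pos[of "z * u powr lam"] z by (simp add: \<phi>_def)
  qed
  have new_integrand: "fox_Xi m (Suc n) new bs (c t) = Gamma (of_real \<omega> - of_real lam * c t) * g t" for t
    by (simp add: new_def fox_Xi_Cons g_def)
  have "fox_H m (Suc n) new bs z = 1 / (2 * of_real pi * \<i>) *
      integral\<^sup>L lborel (\<lambda>u. mellin_kernel (of_real \<omega>) u * I (z * u powr lam))"
    using fox_H_eq[OF new(1,2) real(2) new(3) z contours(2)]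
      integral_spike_vector_derivative[OF swap(1) d(1,2)] swap(3)
    unfolding new_integrand by simp
  also have "\<dots> = of_real (integral\<^sup>L lborel (\<lambda>u. indicator {0<..} u * \<phi> u))"
    unfolding conv integral_mult_right_zero integral_complex_of_real by simp
  finally show ?thesis using \<phi>_pos by (simp add: positive_complex_def new_def)
qed

text \<open>In the reversed order the pair with the largest index is the head, so raising
  \<open>k\<close> by one is a single \<open>Cons\<close> in front.\<close>

lemma fox_list_reversed_Suc:
  "fox_list (\<lambda>j. x (Suc k - j + 1)) (\<lambda>j. X (Suc k - j + 1)) (Suc k)
   = (x (Suc k), X (Suc k)) # fox_list (\<lambda>j. x (k - j + 1)) (\<lambda>j. X (k - j + 1)) k"
proof -
  have "[1..<Suc k + 1] = 1 # map Suc [1..<k + 1]"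
    by (subst upt_conv_Cons) (auto simp: map_Suc_upt)
  then show ?thesis by (simp add: fox_list_def o_def)
qed

lemma fox_real_fox_list: "fox_real (fox_list (\<lambda>j. complex_of_real (x j)) X l)"
  by (auto simp: fox_real_def fox_list_def)

theorem corollary5p2:
  fixes m' n' p' q' k :: nat
    and \<alpha>' A' \<beta>' B' \<omega> lam :: "nat \<Rightarrow> real"
    and as' bs' new :: fox_params
  defines "as' \<equiv> fox_list (\<lambda>j. complex_of_real (\<alpha>' j)) A' p'"
    and "bs' \<equiv> fox_list (\<lambda>j. complex_of_real (\<beta>' j)) B' q'"
    and "new \<equiv> fox_list (\<lambda>j. complex_of_real (1 - \<omega> (k - j + 1))) (\<lambda>j. lam (k - j + 1)) k"
  assumes "fox_defined m' n' as' bs'"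
    and "\<forall>t>0. positive_complex (fox_H m' n' as' bs' t)"
    and "m' * n' > 0"
    and "fox_chi m' n' as' bs' > 0"
    and "k \<ge> 1"
    and "\<forall>j\<in>{1..k}. lam j > 0"
    and "\<forall>j\<in>{1..k}. \<omega> j + lam j * Min ((\<lambda>l. \<beta>' l / B' l) ` {1..m'}) > 0"
  shows "fox_defined m' (n' + k) (new @ as') bs' \<and>
         (\<forall>t>0. positive_complex (fox_H m' (n' + k) (new @ as') bs' t))"
proof -
  \<comment> \<open>The length becomes a variable while \<open>\<omega>\<close> and
    \<open>lam\<close> stay fixed, since the induction passes through all shorter lists.\<close>
  define N where "N k = fox_list (\<lambda>j. complex_of_real (1 - \<omega> (k - j + 1))) (\<lambda>j. lam (k - j + 1)) k" for k
  have N0: "N 0 = []" by (simp add: N_def fox_list_def)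
  have NSuc: "N (Suc k) = (complex_of_real (1 - \<omega> (Suc k)), lam (Suc k)) # N k" for k
    unfolding N_def by (rule fox_list_reversed_Suc[of "\<lambda>j. complex_of_real (1 - \<omega> j)"])
  \<comment> \<open>Definedness gives \<open>m' \<le> q'\<close>, so the first \<open>m'\<close>
    entries of \<open>bs'\<close> are those with the indices over which the minimum is
    taken.\<close>
  have Min_le: "Min ((\<lambda>l. \<beta>' l / B' l) ` {1..m'}) \<le> Re \<beta> / B" if "(\<beta>, B) \<in> set (take m' bs')" for \<beta> B
  proof -
    have "length bs' = q'" by (simp add: bs'_def fox_list_def)
    then have "m' \<le> q'" using assms(4) by (auto simp: fox_defined_def)
    then have "take m' bs' = fox_list (\<lambda>j. complex_of_real (\<beta>' j)) B' m'"
      unfolding bs'_def fox_list_def by (subst take_map, subst take_upt) auto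
    with that have "(\<beta>, B) \<in> (\<lambda>j. (complex_of_real (\<beta>' j), B' j)) ` {1..<m' + 1}"
      by (simp only: fox_list_def set_map set_upt)
    then obtain l where l: "l \<in> {1..<m' + 1}" "\<beta> = of_real (\<beta>' l)" "B = B' l"
      by auto
    then show ?thesis by (intro Min.coboundedI) auto
  qed
  have real: "fox_real bs'" "fox_real as'" unfolding as'_def bs'_def by (rule fox_real_fox_list)+
  \<comment> \<open>The invariant bundles everything the case of one pair consumes.\<close>
  have "fox_defined m' (n' + i) (N i @ as') bs' \<and> fox_real (N i @ as') \<and> fox_chi m' (n' + i) (N i @ as') bs' > 0
      \<and> (\<forall>t>0. positive_complex (fox_H m' (n' + i) (N i @ as') bs' t))" if "i \<le> k" for i
    using that
  proof (induction i)
    case 0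
    then show ?case using assms(4,5,7) real by (simp add: N0)
  next
    case (Suc i)
    then have IH: "fox_defined m' (n' + i) (N i @ as') bs'" "fox_real (N i @ as')"
        "fox_chi m' (n' + i) (N i @ as') bs' > 0"
        "\<And>t. t > 0 \<Longrightarrow> positive_complex (fox_H m' (n' + i) (N i @ as') bs' t)"
      by auto
    have lam: "lam (Suc i) > 0" using assms(9) Suc.prems by auto
    have \<omega>: "\<omega> (Suc i) + lam (Suc i) * (Re \<beta> / B) > 0" if "(\<beta>, B) \<in> set (take m' bs')" for \<beta> B
    proof -
      have "0 < \<omega> (Suc i) + lam (Suc i) * Min ((\<lambda>l. \<beta>' l / B' l) ` {1..m'})"
        using assms(10) Suc.prems by auto
      also have "\<dots> \<le> \<omega> (Suc i) + lam (Suc i) * (Re \<beta> / B)"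
        using Min_le[OF that] lam by (intro add_left_mono mult_left_mono) auto
      finally show ?thesis .
    qed
    show ?case
      using fox_defined_Cons[OF IH(1) real(1) lam \<omega>] fox_H_Cons_positive[OF IH(1,2) real(1) IH(3,4) lam \<omega>]
        IH(2,3) lam
      by (simp add: NSuc fox_real_Cons fox_chi_Cons)
  qed
  from this[of k] show ?thesis by (simp add: new_def N_def)
qed

end
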